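(* Let $\alpha\in\mathbb{R}$. The assignment $$\hat\Lambda^{\mathrm q}_{S,1,\alpha}:Z\hat C^{1}(\Delta_T^3;B_\alpha)\to\mathfrak Q^{1,\alpha}_{\mathrm{fr},\log},\qquad h\mapsto\hat\Lambda^{\mathrm q}_{S,1,\alpha}h,\qquad\bigl(\hat\Lambda^{\mathrm q}_{S,1,\alpha}h\bigr)^\tau:=[r^\tau_{\mathrm d}(h)]_\tau,$$ is a well-defined continuous linear map. It satisfies the following properties: (1) for every $\tau\in[0,T]$ and every representative $r^\tau\in(\hat\Lambda^{\mathrm q}_{S,1,\alpha}h)^\tau$, $\delta r^\tau=h^\tau$; (2) in particular, for every $0\le s\le u\le t\le T$ and every representative $r^t\in(\hat\Lambda^{\mathrm q}_{S,1,\alpha}h)^t$, $(\delta r^t)_{tus}=h_{tus}$; (3) for every $h\in Z\hat C^{1}(\Delta_T^3;B_\alpha)$, the uniform estimate $\|\hat\Lambda^{\mathrm q}_{S,1,\alpha}h\|_{\mathfrak Q^{1,\alpha}_{\mathrm{fr},\log}}\le C_TM_{\alpha,T}\|h\|_{1,\alpha}$ holds, with $C_T$ independent of $h$.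
   Context: Fix $T>0$. $(B_\alpha)_{\alpha\in\mathbb{R}}$ is a Banach scale, i.e. a family of Banach spaces such that for $\alpha\le\beta$ the embedding $B_\beta\hookrightarrow B_\alpha$ is continuous. $S=(S_t)_{t\ge0}$ is an analytic (in particular strongly continuous) semigroup of bounded linear operators acting on this scale, with $S_0=\mathrm{Id}$; for every $\alpha\in\mathbb{R}$, $\varepsilon\in(0,1)$ there is $C_{\alpha,\varepsilon,T}>0$ with $\|S_tx\|_{B_{\alpha+\varepsilon}}\le C_{\alpha,\varepsilon,T}t^{-\varepsilon}\|x\|_{B_\alpha}$ and $\|(S_t-\mathrm{Id})x\|_{B_\alpha}\le C_{\alpha,\varepsilon,T}t^{\varepsilon}\|x\|_{B_{\alpha+\varepsilon}}$ for all $t\in(0,T]$. $M_{\alpha,T}:=\sup_{0\le r\le T}\|S_r\|_{\mathcal L(B_\alpha,B_\alpha)}<\infty$. For $\tau\in[0,T]$, $\Delta_\tau^n:=\{(t_1,\dots,t_n)\in[0,\tau]^n:0\le t_n\le\dots\le t_1\le\tau\}$; $C(\Delta_\tau^n;B_\alpha)$ denotes continuous maps; $(\delta g)_{t_1\dots t_{n+1}}:=\sum_{i=1}^{n+1}(-1)^ig_{t_1\dots\hat t_i\dots t_{n+1}}$ (for a path, $(\delta I)_{ts}=I_t-I_s$); on $C(\Delta_T^n;B_\alpha)$, $(\hat\delta g)_{t_1\dots t_{n+1}}:=(\delta g)_{t_1\dots t_{n+1}}-(S_{t_1-t_2}-\mathrm{Id})g_{t_2\dots t_{n+1}}$. Norms: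 for $g\in C(\Delta_\tau^2;B_\alpha)$, $\|g\|_{\mu,\alpha;\tau}:=\sup_{0\le s<t\le\tau}\|g_{ts}\|_{B_\alpha}/|t-s|^\mu$ and $\|g\|_{1,\log;\tau,\alpha}:=\sup_{0\le s<t\le\tau}\frac{\|g_{ts}\|_{B_\alpha}}{|t-s|(1+|\log|t-s||)}$; $C^1_{\log}(\Delta_\tau^2;B_\alpha)$ is the subset of $C(\Delta_\tau^2;B_\alpha)$ where the latter is finite. For $h\in C(\Delta_\tau^3;B_\alpha)$, $\|h\|_{1,\alpha;\tau}:=\inf\{\sum_{j=1}^m\sup_{0\le s<u<t\le\tau}\frac{\|h_{j,tus}\|_{B_\alpha}}{|t-u|^{\rho_j}|u-s|^{1-\rho_j}}:h=\sum_{j=1}^mh_j,\ m\in\mathbb{N},\ 0<\rho_j<1\}$; $C^1(\Delta_\tau^3;B_\alpha)$ is the set where it is finite; the index $\tau$ is dropped when $\tau=T$. $ZC^1(\Delta_\tau^3;B_\alpha):=\ker(\delta)\cap C^1(\Delta_\tau^3;B_\alpha)$, $Z\hat C^1(\Delta_T^3;B_\alpha):=\ker(\hat\delta)\cap C^1(\Delta_T^3;B_\alpha)$. Dyadic frozen increments: let $\mathcal A^1(\Delta_\tau^2;B_\alpha):=\{A\in C(\Delta_\tau^2;B_\alpha):\delta A\in C^1(\Delta_\tau^3;B_\alpha)\}$. Fix, for each $\tau$, a linear map $\mathcal I^{\mathrm d}_\tau:\mathcal A^1(\Delta_\tau^2;B_\alpha)\to C([0,\tau];B_\alpha)$ (the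 normalized dyadic ordinary low-regularity sewing map, obtained from a dyadic recursion on $\bigcup_n\{k2^{-n}\tau:0\le k\le2^n\}$ and continuous extension; such maps exist) such that for every $A$: $\mathcal I^{\mathrm d}_\tau(A)_0=0$, and $\mathcal R^{\mathrm d}_\tau(A):=A-\delta\mathcal I^{\mathrm d}_\tau(A)$ satisfies $\delta\mathcal R^{\mathrm d}_\tau(A)=\delta A$, $\mathcal R^{\mathrm d}_\tau(A)\in C^1_{\log}(\Delta_\tau^2;B_\alpha)$, $\|\mathcal R^{\mathrm d}_\tau(A)\|_{1,\log;\tau,\alpha}\le C_T\|\delta A\|_{1,\alpha;\tau}$ and, for every $\varepsilon\in(0,1)$, $\|\mathcal R^{\mathrm d}_\tau(A)\|_{1-\varepsilon,\alpha;\tau}\le C_{\varepsilon,T}\|\delta A\|_{1,\alpha;\tau}$, with constants independent of $\tau$. For $k\in ZC^1(\Delta_\tau^3;B_\alpha)$ set $b^k_{ts}:=-k_{ts0}$ and $\Lambda^{\mathrm d}_\tau k:=\mathcal R^{\mathrm d}_\tau(b^k)$. For $h\in Z\hat C^1(\Delta_T^3;B_\alpha)$ let $h^\tau_{tus}:=S_{\tau-t}h_{tus}$ on $\Delta_\tau^3$ (it lies in $ZC^1(\Delta_\tau^3;B_\alpha)$) and $r^\tau_{\mathrm d}(h):=\Lambda^{\mathrm d}_\tau(h^\tau)$. Quotients: $ZC(\Delta_\tau^2;B_\alpha):=\ker(\delta)\cap C(\Delta_\tau^2;B_\alpha)$; for $r\in C(\Delta_\tau^2;B_\alpha)$, $[r]_\tau$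 is its class modulo $ZC(\Delta_\tau^2;B_\alpha)$. $\mathfrak C^1_{\log}(\Delta_\tau^2;B_\alpha):=\{[r]_\tau:[r]_\tau\cap C^1_{\log}(\Delta_\tau^2;B_\alpha)\ne\varnothing\}$ with seminorm $\|[r]_\tau\|_{\mathfrak C_{2,\log}^{1,\alpha}(\tau)}:=\inf\{\|\widetilde r\|_{1,\log;\tau,\alpha}:\widetilde r\in[r]_\tau\cap C^1_{\log}(\Delta_\tau^2;B_\alpha)\}$. For $0\le\tau'\le\tau\le T$: $\operatorname{Res}_{\tau,\tau'}[r]_\tau:=[r|_{\Delta_{\tau'}^2}]_{\tau'}$ and $\mathcal T_{\tau,\tau'}[q]_{\tau'}:=[S_{\tau-\tau'}q]_{\tau'}$. $\mathfrak Q^{1,\alpha}_{\mathrm{fr},\log}$ is the vector space of families $\mathfrak r=(\mathfrak r^\tau)_{\tau\in[0,T]}$ with $\mathfrak r^\tau\in\mathfrak C^1_{\log}(\Delta_\tau^2;B_\alpha)$, $\operatorname{Res}_{\tau,\tau'}\mathfrak r^\tau=\mathcal T_{\tau,\tau'}\mathfrak r^{\tau'}$ for all $0\le\tau'\le\tau\le T$, and $\|\mathfrak r\|_{\mathfrak Q^{1,\alpha}_{\mathrm{fr},\log}}:=\sup_{\tau\in[0,T]}\|\mathfrak r^\tau\|_{\mathfrak C_{2,\log}^{1,\alpha}(\tau)}<\infty$. *)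

theory Defs
  imports "HOL-Analysis.Analysis"
begin

text \<open>
  A single Banach space is a linear subspace \<open>X\<close> of an ambient real vector space, together with
  its own norm \<open>N\<close> (only the values of \<open>N\<close> on \<open>X\<close> matter).  A Banach scale is then a family of
  such pairs in one ambient space; as the embeddings of a scale are injective and compatible,
  they become inclusions after passing to the union (direct limit) of the scale.
\<close>

locale banach_on =
  fixes X :: "'v::real_vector set" and N :: "'v \<Rightarrow> real"
  assumes subspace: "subspace X"
    and norm_nonneg: "x \<in> X \<Longrightarrow> 0 \<le> N x"
    and norm_eq_0: "x \<in> X \<Longrightarrow> N x = 0 \<longleftrightarrow> x = 0"
    and norm_scale: "x \<in> X \<Longrightarrow> N (c *\<^sub>R x) = \<bar>c\<bar> * N x"
    and norm_triangle: "x \<in> X \<Longrightarrow> y \<in> X \<Longrightarrow> N (x + y) \<le> N x + N y"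
    and complete:
      "(\<forall>n. f n \<in> X) \<Longrightarrow> (\<forall>e>0. \<exists>n0. \<forall>m\<ge>n0. \<forall>n\<ge>n0. N (f m - f n) < e)
        \<Longrightarrow> \<exists>l\<in>X. (\<lambda>n. N (f n - l)) \<longlonglongrightarrow> 0"

locale banach_scale =
  fixes B :: "real \<Rightarrow> 'v::real_vector set" and N :: "real \<Rightarrow> 'v \<Rightarrow> real"
  assumes banach: "banach_on (B \<alpha>) (N \<alpha>)"
    and embed: "\<alpha> \<le> \<beta> \<Longrightarrow> B \<beta> \<subseteq> B \<alpha>"
    and embed_bounded: "\<alpha> \<le> \<beta> \<Longrightarrow> \<exists>C. \<forall>x\<in>B \<beta>. N \<alpha> x \<le> C * N \<beta> x"

definition bounded_operator_on :: "'v::real_vector set \<Rightarrow> ('v \<Rightarrow> real) \<Rightarrow> ('v \<Rightarrow> 'v) \<Rightarrow> bool" where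
  "bounded_operator_on X N f \<longleftrightarrow>
     (\<forall>x\<in>X. f x \<in> X) \<and>
     (\<forall>x\<in>X. \<forall>y\<in>X. f (x + y) = f x + f y) \<and>
     (\<forall>x\<in>X. \<forall>c. f (c *\<^sub>R x) = c *\<^sub>R f x) \<and>
     (\<exists>C. \<forall>x\<in>X. N (f x) \<le> C * N x)"

definition operator_norm :: "'v::real_vector set \<Rightarrow> ('v \<Rightarrow> real) \<Rightarrow> ('v \<Rightarrow> 'v) \<Rightarrow> ennreal" where
  "operator_norm X N f = (SUP x\<in>{x\<in>X. N x \<le> 1}. ennreal (N (f x)))"

locale C0_semigroup_on = banach_on X N
  for X :: "'v::real_vector set" and N :: "'v \<Rightarrow> real" +
  fixes S :: "real \<Rightarrow> 'v \<Rightarrow> 'v"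
  assumes bounded: "0 \<le> t \<Longrightarrow> bounded_operator_on X N (S t)"
    and zero: "x \<in> X \<Longrightarrow> S 0 x = x"
    and add: "0 \<le> s \<Longrightarrow> 0 \<le> t \<Longrightarrow> x \<in> X \<Longrightarrow> S (s + t) x = S s (S t x)"
    and strongly_continuous: "x \<in> X \<Longrightarrow> ((\<lambda>t. N (S t x - x)) \<longlongrightarrow> 0) (at_right 0)"

definition sector :: "real \<Rightarrow> complex set" where
  "sector \<theta> = {z. z \<noteq> 0 \<and> \<bar>Arg z\<bar> < \<theta>}"

text \<open>
  A semigroup is analytic if it extends to a strongly continuous holomorphic semigroup
  \<open>Z\<close> on a sector around the positive half-line.  As \<open>X\<close> is a real Banach space, \<open>Z\<close> acts on its
  complexification; writing \<open>Z z x = P z x + i Q z x\<close> for \<open>x\<close> in \<open>X\<close>, the bounded operators \<open>P z\<close>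
  and \<open>Q z\<close> on \<open>X\<close> determine \<open>Z z\<close>.  In the last clause \<open>p + i q\<close> is the complex derivative of
  \<open>w \<mapsto> Z w x\<close> at \<open>z\<close>.
\<close>

definition analytic_extension ::
  "'v::real_vector set \<Rightarrow> ('v \<Rightarrow> real) \<Rightarrow> (real \<Rightarrow> 'v \<Rightarrow> 'v) \<Rightarrow> real \<Rightarrow>
   (complex \<Rightarrow> 'v \<Rightarrow> 'v) \<Rightarrow> (complex \<Rightarrow> 'v \<Rightarrow> 'v) \<Rightarrow> bool" where
  "analytic_extension X N S \<theta> P Q \<longleftrightarrow>
     (\<forall>z\<in>sector \<theta>. bounded_operator_on X N (P z) \<and> bounded_operator_on X N (Q z)) \<and>
     (\<forall>t>0. \<forall>x\<in>X. P (complex_of_real t) x = S t x \<and> Q (complex_of_real t) x = 0) \<and>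
     (\<forall>z\<in>sector \<theta>. \<forall>w\<in>sector \<theta>. \<forall>x\<in>X.
        P (z + w) x = P z (P w x) - Q z (Q w x) \<and>
        Q (z + w) x = P z (Q w x) + Q z (P w x)) \<and>
     (\<forall>x\<in>X. ((\<lambda>z. N (P z x - x) + N (Q z x)) \<longlongrightarrow> 0) (at 0 within sector \<theta>)) \<and>
     (\<forall>z\<in>sector \<theta>. \<forall>x\<in>X. \<exists>p\<in>X. \<exists>q\<in>X.
        ((\<lambda>w. (N (P w x - P z x - (Re (w - z) *\<^sub>R p - Im (w - z) *\<^sub>R q))
             + N (Q w x - Q z x - (Re (w - z) *\<^sub>R q + Im (w - z) *\<^sub>R p))) / cmod (w - z))
          \<longlongrightarrow> 0) (at z))"

definition analytic_on_space ::
  "'v::real_vector set \<Rightarrow> ('v \<Rightarrow> real) \<Rightarrow> (real \<Rightarrow> 'v \<Rightarrow> 'v) \<Rightarrow> bool" where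
  "analytic_on_space X N S \<longleftrightarrow> (\<exists>\<theta> P Q. 0 < \<theta> \<and> \<theta> \<le> pi / 2 \<and> analytic_extension X N S \<theta> P Q)"

definition semigroup_bound ::
  "'v::real_vector set \<Rightarrow> ('v \<Rightarrow> real) \<Rightarrow> real \<Rightarrow> (real \<Rightarrow> 'v \<Rightarrow> 'v) \<Rightarrow> ennreal" where
  "semigroup_bound X N T S = (SUP r\<in>{0..T}. operator_norm X N (S r))"

locale analytic_semigroup_on_scale = banach_scale B N
  for B :: "real \<Rightarrow> 'v::real_vector set" and N :: "real \<Rightarrow> 'v \<Rightarrow> real" +
  fixes T :: real and S :: "real \<Rightarrow> 'v \<Rightarrow> 'v"
  assumes semigroup: "C0_semigroup_on (B \<alpha>) (N \<alpha>) S"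
    and analytic: "analytic_on_space (B \<alpha>) (N \<alpha>) S"
    and regularization: "0 < \<epsilon> \<Longrightarrow> \<epsilon> < 1 \<Longrightarrow>
      \<exists>C>0. \<forall>t. 0 < t \<and> t \<le> T \<longrightarrow>
        (\<forall>x\<in>B \<alpha>. S t x \<in> B (\<alpha> + \<epsilon>) \<and> N (\<alpha> + \<epsilon>) (S t x) \<le> C * t powr (- \<epsilon>) * N \<alpha> x) \<and>
        (\<forall>x\<in>B (\<alpha> + \<epsilon>). N \<alpha> (S t x - x) \<le> C * t powr \<epsilon> * N (\<alpha> + \<epsilon>) x)"
    and bound_finite: "semigroup_bound (B \<alpha>) (N \<alpha>) T S < \<infinity>"

text \<open>
  Points \<open>(t\<^sub>1, \<dots>, t\<^sub>n)\<close> of a dsimplex are lists \<open>[t\<^sub>1, \<dots>, t\<^sub>n]\<close>; \<open>dsimplex 1 \<tau>\<close> is the interval \<open>[0, \<tau>]\<close>.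
  A map on a dsimplex is represented by its extension by zero to all lists.  These extensions form
  a vector space under the pointwise operations, and they agree iff the maps agree on the dsimplex.
\<close>

definition dsimplex :: "nat \<Rightarrow> real \<Rightarrow> real list set" where
  "dsimplex n \<tau> = {ts. length ts = n \<and> set ts \<subseteq> {0..\<tau>} \<and> sorted_wrt (\<ge>) ts}"

definition restr :: "nat \<Rightarrow> real \<Rightarrow> (real list \<Rightarrow> 'v::real_vector) \<Rightarrow> real list \<Rightarrow> 'v" where
  "restr n \<tau> g = (\<lambda>ts. if ts \<in> dsimplex n \<tau> then g ts else 0)"

definition cont_maps ::
  "'v::real_vector set \<Rightarrow> ('v \<Rightarrow> real) \<Rightarrow> nat \<Rightarrow> real \<Rightarrow> (real list \<Rightarrow> 'v) set" where
  "cont_maps X N n \<tau> = {g. (\<forall>ts\<in>dsimplex n \<tau>. g ts \<in> X) \<and> (\<forall>ts. ts \<notin> dsimplex n \<tau> \<longrightarrow> g ts = 0) \<and>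
     (\<forall>ts\<in>dsimplex n \<tau>. \<forall>e>0. \<exists>d>0. \<forall>us\<in>dsimplex n \<tau>.
        (\<forall>i<n. \<bar>us ! i - ts ! i\<bar> < d) \<longrightarrow> N (g us - g ts) < e)}"

text \<open>
  \<open>\<delta>\<close> and \<open>\<delta>\<close>-hat map functions on \<open>dsimplex n \<tau>\<close> to functions on \<open>dsimplex (Suc n) \<tau>\<close>.  List positions
  start at \<open>0\<close>, so omitting position \<open>i\<close> carries the sign \<open>(-1) ^ (i + 1)\<close>.
\<close>

definition delta :: "nat \<Rightarrow> real \<Rightarrow> (real list \<Rightarrow> 'v::real_vector) \<Rightarrow> real list \<Rightarrow> 'v" where
  "delta n \<tau> g = restr (Suc n) \<tau>
     (\<lambda>ts. \<Sum>i\<le>n. (- 1) ^ Suc i *\<^sub>R g (take i ts @ drop (Suc i) ts))"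

definition delta_hat ::
  "(real \<Rightarrow> 'v \<Rightarrow> 'v) \<Rightarrow> nat \<Rightarrow> real \<Rightarrow> (real list \<Rightarrow> 'v::real_vector) \<Rightarrow> real list \<Rightarrow> 'v" where
  "delta_hat S n \<tau> g = restr (Suc n) \<tau>
     (\<lambda>ts. delta n \<tau> g ts - (S (ts ! 0 - ts ! 1) (g (tl ts)) - g (tl ts)))"

text \<open>All (semi)norms take values in \<open>[0, \<infinity>]\<close>.\<close>

definition holder_norm ::
  "('v \<Rightarrow> real) \<Rightarrow> real \<Rightarrow> real \<Rightarrow> (real list \<Rightarrow> 'v::real_vector) \<Rightarrow> ennreal" where
  "holder_norm N \<mu> \<tau> g =
     (SUP (t, s)\<in>{(t, s). 0 \<le> s \<and> s < t \<and> t \<le> \<tau>}. ennreal (N (g [t, s]) / \<bar>t - s\<bar> powr \<mu>))"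

definition log_norm ::
  "('v \<Rightarrow> real) \<Rightarrow> real \<Rightarrow> (real list \<Rightarrow> 'v::real_vector) \<Rightarrow> ennreal" where
  "log_norm N \<tau> g =
     (SUP (t, s)\<in>{(t, s). 0 \<le> s \<and> s < t \<and> t \<le> \<tau>}.
        ennreal (N (g [t, s]) / (\<bar>t - s\<bar> * (1 + \<bar>ln \<bar>t - s\<bar>\<bar>))))"

definition C_log ::
  "'v::real_vector set \<Rightarrow> ('v \<Rightarrow> real) \<Rightarrow> real \<Rightarrow> (real list \<Rightarrow> 'v) set" where
  "C_log X N \<tau> = {g \<in> cont_maps X N 2 \<tau>. log_norm N \<tau> g < \<infinity>}"

definition split_norm ::
  "('v \<Rightarrow> real) \<Rightarrow> real \<Rightarrow> real \<Rightarrow> (real list \<Rightarrow> 'v::real_vector) \<Rightarrow> ennreal" where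
  "split_norm N \<rho> \<tau> h =
     (SUP (t, u, s)\<in>{(t, u, s). 0 \<le> s \<and> s < u \<and> u < t \<and> t \<le> \<tau>}.
        ennreal (N (h [t, u, s]) / (\<bar>t - u\<bar> powr \<rho> * \<bar>u - s\<bar> powr (1 - \<rho>))))"

definition norm1 ::
  "'v::real_vector set \<Rightarrow> ('v \<Rightarrow> real) \<Rightarrow> real \<Rightarrow> (real list \<Rightarrow> 'v) \<Rightarrow> ennreal" where
  "norm1 X N \<tau> h =
     Inf {(\<Sum>j<m. split_norm N (\<rho> j) \<tau> (H j)) |(m::nat) \<rho> H.
        (\<forall>j<m. 0 < \<rho> j \<and> \<rho> j < 1 \<and> H j \<in> cont_maps X N 3 \<tau>) \<and> h = (\<lambda>ts. \<Sum>j<m. H j ts)}"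

definition C1 ::
  "'v::real_vector set \<Rightarrow> ('v \<Rightarrow> real) \<Rightarrow> real \<Rightarrow> (real list \<Rightarrow> 'v) set" where
  "C1 X N \<tau> = {h \<in> cont_maps X N 3 \<tau>. norm1 X N \<tau> h < \<infinity>}"

definition ZC1 ::
  "'v::real_vector set \<Rightarrow> ('v \<Rightarrow> real) \<Rightarrow> real \<Rightarrow> (real list \<Rightarrow> 'v) set" where
  "ZC1 X N \<tau> = {h \<in> C1 X N \<tau>. delta 3 \<tau> h = (\<lambda>_. 0)}"

definition ZC1_hat ::
  "'v::real_vector set \<Rightarrow> ('v \<Rightarrow> real) \<Rightarrow> (real \<Rightarrow> 'v \<Rightarrow> 'v) \<Rightarrow> real \<Rightarrow> (real list \<Rightarrow> 'v) set" where
  "ZC1_hat X N S T = {h \<in> C1 X N T. delta_hat S 3 T h = (\<lambda>_. 0)}"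

definition A1 ::
  "'v::real_vector set \<Rightarrow> ('v \<Rightarrow> real) \<Rightarrow> real \<Rightarrow> (real list \<Rightarrow> 'v) set" where
  "A1 X N \<tau> = {A \<in> cont_maps X N 2 \<tau>. delta 2 \<tau> A \<in> C1 X N \<tau>}"

text \<open>\<open>I \<tau>\<close> is the ordinary sewing map on \<open>[0, \<tau>]\<close> and \<open>remainder I \<tau>\<close> its remainder map.\<close>

definition remainder ::
  "(real \<Rightarrow> (real list \<Rightarrow> 'v) \<Rightarrow> real list \<Rightarrow> 'v::real_vector) \<Rightarrow>
   real \<Rightarrow> (real list \<Rightarrow> 'v) \<Rightarrow> real list \<Rightarrow> 'v" where
  "remainder I \<tau> A = (\<lambda>ts. A ts - delta 1 \<tau> (I \<tau> A) ts)"

text \<open>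
  The normalized dyadic sewing maps are given through their defining properties; \<open>C\<^sub>T\<close> is the
  constant of the logarithmic estimate.
\<close>

locale dyadic_sewing =
  fixes X :: "'v::real_vector set" and N :: "'v \<Rightarrow> real" and T :: real
    and I :: "real \<Rightarrow> (real list \<Rightarrow> 'v) \<Rightarrow> real list \<Rightarrow> 'v" and C\<^sub>T :: real
  assumes path: "0 \<le> \<tau> \<Longrightarrow> \<tau> \<le> T \<Longrightarrow> A \<in> A1 X N \<tau> \<Longrightarrow> I \<tau> A \<in> cont_maps X N 1 \<tau>"
    and additive: "0 \<le> \<tau> \<Longrightarrow> \<tau> \<le> T \<Longrightarrow> A \<in> A1 X N \<tau> \<Longrightarrow> A' \<in> A1 X N \<tau> \<Longrightarrow>
      I \<tau> (\<lambda>ts. A ts + A' ts) = (\<lambda>ts. I \<tau> A ts + I \<tau> A' ts)"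
    and homogeneous: "0 \<le> \<tau> \<Longrightarrow> \<tau> \<le> T \<Longrightarrow> A \<in> A1 X N \<tau> \<Longrightarrow>
      I \<tau> (\<lambda>ts. c *\<^sub>R A ts) = (\<lambda>ts. c *\<^sub>R I \<tau> A ts)"
    and normalized: "0 \<le> \<tau> \<Longrightarrow> \<tau> \<le> T \<Longrightarrow> A \<in> A1 X N \<tau> \<Longrightarrow> I \<tau> A [0] = 0"
    and delta_remainder: "0 \<le> \<tau> \<Longrightarrow> \<tau> \<le> T \<Longrightarrow> A \<in> A1 X N \<tau> \<Longrightarrow>
      delta 2 \<tau> (remainder I \<tau> A) = delta 2 \<tau> A"
    and remainder_log: "0 \<le> \<tau> \<Longrightarrow> \<tau> \<le> T \<Longrightarrow> A \<in> A1 X N \<tau> \<Longrightarrow> remainder I \<tau> A \<in> C_log X N \<tau>"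
    and const_pos: "0 < C\<^sub>T"
    and log_estimate: "0 \<le> \<tau> \<Longrightarrow> \<tau> \<le> T \<Longrightarrow> A \<in> A1 X N \<tau> \<Longrightarrow>
      log_norm N \<tau> (remainder I \<tau> A) \<le> ennreal C\<^sub>T * norm1 X N \<tau> (delta 2 \<tau> A)"
    and holder_estimate: "0 < \<epsilon> \<Longrightarrow> \<epsilon> < 1 \<Longrightarrow>
      \<exists>C>0. \<forall>\<tau> A. 0 \<le> \<tau> \<and> \<tau> \<le> T \<and> A \<in> A1 X N \<tau> \<longrightarrow>
        holder_norm N (1 - \<epsilon>) \<tau> (remainder I \<tau> A) \<le> ennreal C * norm1 X N \<tau> (delta 2 \<tau> A)"

definition base_germ :: "real \<Rightarrow> (real list \<Rightarrow> 'v::real_vector) \<Rightarrow> real list \<Rightarrow> 'v" where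
  "base_germ \<tau> k = restr 2 \<tau> (\<lambda>ts. - k (ts @ [0]))"

definition Lambda_d ::
  "(real \<Rightarrow> (real list \<Rightarrow> 'v) \<Rightarrow> real list \<Rightarrow> 'v::real_vector) \<Rightarrow>
   real \<Rightarrow> (real list \<Rightarrow> 'v) \<Rightarrow> real list \<Rightarrow> 'v" where
  "Lambda_d I \<tau> k = remainder I \<tau> (base_germ \<tau> k)"

definition frozen ::
  "(real \<Rightarrow> 'v \<Rightarrow> 'v) \<Rightarrow> real \<Rightarrow> (real list \<Rightarrow> 'v::real_vector) \<Rightarrow> real list \<Rightarrow> 'v" where
  "frozen S \<tau> h = restr 3 \<tau> (\<lambda>ts. S (\<tau> - ts ! 0) (h ts))"

definition r_d ::
  "(real \<Rightarrow> 'v \<Rightarrow> 'v) \<Rightarrow> (real \<Rightarrow> (real list \<Rightarrow> 'v) \<Rightarrow> real list \<Rightarrow> 'v::real_vector) \<Rightarrow>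
   real \<Rightarrow> (real list \<Rightarrow> 'v) \<Rightarrow> real list \<Rightarrow> 'v" where
  "r_d S I \<tau> h = Lambda_d I \<tau> (frozen S \<tau> h)"

definition ZC ::
  "'v::real_vector set \<Rightarrow> ('v \<Rightarrow> real) \<Rightarrow> real \<Rightarrow> (real list \<Rightarrow> 'v) set" where
  "ZC X N \<tau> = {r \<in> cont_maps X N 2 \<tau>. delta 2 \<tau> r = (\<lambda>_. 0)}"

definition qclass ::
  "'v::real_vector set \<Rightarrow> ('v \<Rightarrow> real) \<Rightarrow> real \<Rightarrow> (real list \<Rightarrow> 'v) \<Rightarrow> (real list \<Rightarrow> 'v) set" where
  "qclass X N \<tau> r = {r' \<in> cont_maps X N 2 \<tau>. (\<lambda>ts. r' ts - r ts) \<in> ZC X N \<tau>}"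

definition QC_log ::
  "'v::real_vector set \<Rightarrow> ('v \<Rightarrow> real) \<Rightarrow> real \<Rightarrow> (real list \<Rightarrow> 'v) set set" where
  "QC_log X N \<tau> =
     {qclass X N \<tau> r |r. r \<in> cont_maps X N 2 \<tau> \<and> qclass X N \<tau> r \<inter> C_log X N \<tau> \<noteq> {}}"

definition qnorm ::
  "'v::real_vector set \<Rightarrow> ('v \<Rightarrow> real) \<Rightarrow> real \<Rightarrow> (real list \<Rightarrow> 'v) set \<Rightarrow> ennreal" where
  "qnorm X N \<tau> c = (INF r\<in>c \<inter> C_log X N \<tau>. log_norm N \<tau> r)"

text \<open>
  Operations on classes take the union of the classes obtained from all representatives.  If the
  result does not depend on the representatives, this union is that one class.
\<close>

definition qadd ::
  "'v::real_vector set \<Rightarrow> ('v \<Rightarrow> real) \<Rightarrow> real \<Rightarrow>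
   (real list \<Rightarrow> 'v) set \<Rightarrow> (real list \<Rightarrow> 'v) set \<Rightarrow> (real list \<Rightarrow> 'v) set" where
  "qadd X N \<tau> c d = (\<Union>r\<in>c. \<Union>q\<in>d. qclass X N \<tau> (\<lambda>ts. r ts + q ts))"

definition qscale ::
  "'v::real_vector set \<Rightarrow> ('v \<Rightarrow> real) \<Rightarrow> real \<Rightarrow> real \<Rightarrow>
   (real list \<Rightarrow> 'v) set \<Rightarrow> (real list \<Rightarrow> 'v) set" where
  "qscale X N \<tau> a c = (\<Union>r\<in>c. qclass X N \<tau> (\<lambda>ts. a *\<^sub>R r ts))"

definition Res ::
  "'v::real_vector set \<Rightarrow> ('v \<Rightarrow> real) \<Rightarrow> real \<Rightarrow> (real list \<Rightarrow> 'v) set \<Rightarrow> (real list \<Rightarrow> 'v) set" where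
  "Res X N \<tau>' c = (\<Union>r\<in>c. qclass X N \<tau>' (restr 2 \<tau>' r))"

definition Trans ::
  "'v::real_vector set \<Rightarrow> ('v \<Rightarrow> real) \<Rightarrow> (real \<Rightarrow> 'v \<Rightarrow> 'v) \<Rightarrow> real \<Rightarrow> real \<Rightarrow>
   (real list \<Rightarrow> 'v) set \<Rightarrow> (real list \<Rightarrow> 'v) set" where
  "Trans X N S \<tau> \<tau>' c = (\<Union>q\<in>c. qclass X N \<tau>' (restr 2 \<tau>' (\<lambda>ts. S (\<tau> - \<tau>') (q ts))))"

text \<open>Families indexed by \<open>[0, T]\<close> are functions that are \<open>undefined\<close> outside \<open>{0..T}\<close>.\<close>

definition fam_norm ::
  "'v::real_vector set \<Rightarrow> ('v \<Rightarrow> real) \<Rightarrow> real \<Rightarrow> (real \<Rightarrow> (real list \<Rightarrow> 'v) set) \<Rightarrow> ennreal" where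
  "fam_norm X N T \<rr> = (SUP \<tau>\<in>{0..T}. qnorm X N \<tau> (\<rr> \<tau>))"

definition Q_fr ::
  "'v::real_vector set \<Rightarrow> ('v \<Rightarrow> real) \<Rightarrow> (real \<Rightarrow> 'v \<Rightarrow> 'v) \<Rightarrow> real \<Rightarrow>
   (real \<Rightarrow> (real list \<Rightarrow> 'v) set) set" where
  "Q_fr X N S T = {\<rr> \<in> (\<Pi>\<^sub>E \<tau>\<in>{0..T}. QC_log X N \<tau>).
     (\<forall>\<tau> \<tau>'. 0 \<le> \<tau>' \<and> \<tau>' \<le> \<tau> \<and> \<tau> \<le> T \<longrightarrow> Res X N \<tau>' (\<rr> \<tau>) = Trans X N S \<tau> \<tau>' (\<rr> \<tau>')) \<and>
     fam_norm X N T \<rr> < \<infinity>}"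

definition fam_add ::
  "'v::real_vector set \<Rightarrow> ('v \<Rightarrow> real) \<Rightarrow> real \<Rightarrow> (real \<Rightarrow> (real list \<Rightarrow> 'v) set) \<Rightarrow>
   (real \<Rightarrow> (real list \<Rightarrow> 'v) set) \<Rightarrow> real \<Rightarrow> (real list \<Rightarrow> 'v) set" where
  "fam_add X N T \<rr> \<qq> = (\<lambda>\<tau>\<in>{0..T}. qadd X N \<tau> (\<rr> \<tau>) (\<qq> \<tau>))"

definition fam_scale ::
  "'v::real_vector set \<Rightarrow> ('v \<Rightarrow> real) \<Rightarrow> real \<Rightarrow> real \<Rightarrow> (real \<Rightarrow> (real list \<Rightarrow> 'v) set) \<Rightarrow>
   real \<Rightarrow> (real list \<Rightarrow> 'v) set" where
  "fam_scale X N T a \<rr> = (\<lambda>\<tau>\<in>{0..T}. qscale X N \<tau> a (\<rr> \<tau>))"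

definition fam_diff ::
  "'v::real_vector set \<Rightarrow> ('v \<Rightarrow> real) \<Rightarrow> real \<Rightarrow> (real \<Rightarrow> (real list \<Rightarrow> 'v) set) \<Rightarrow>
   (real \<Rightarrow> (real list \<Rightarrow> 'v) set) \<Rightarrow> real \<Rightarrow> (real list \<Rightarrow> 'v) set" where
  "fam_diff X N T \<rr> \<qq> = fam_add X N T \<rr> (fam_scale X N T (- 1) \<qq>)"

definition Lambda_q ::
  "'v::real_vector set \<Rightarrow> ('v \<Rightarrow> real) \<Rightarrow> (real \<Rightarrow> 'v \<Rightarrow> 'v) \<Rightarrow>
   (real \<Rightarrow> (real list \<Rightarrow> 'v) \<Rightarrow> real list \<Rightarrow> 'v) \<Rightarrow> real \<Rightarrow>
   (real list \<Rightarrow> 'v) \<Rightarrow> real \<Rightarrow> (real list \<Rightarrow> 'v) set" where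
  "Lambda_q X N S I T h = (\<lambda>\<tau>\<in>{0..T}. qclass X N \<tau> (r_d S I \<tau> h))"

end

theory Submission
  imports Defs
begin

text \<open>
  For each terminal time \<open>\<tau>\<close>, freezing replaces \<open>h\<^sub>t\<^sub>u\<^sub>s\<close> by \<open>S\<^bsub>\<tau> - t\<^esub> h\<^sub>t\<^sub>u\<^sub>s\<close>.  The point of this
  substitution is that it turns the twisted coboundary into the ordinary one: applying \<open>S\<^bsub>\<tau> - v\<^esub>\<close> to
  the twisted cocycle identity at \<open>v \<ge> t \<ge> u \<ge> s\<close>, the only term carrying a semigroup factor,
  \<open>S\<^bsub>v - t\<^esub> h\<^sub>t\<^sub>u\<^sub>s\<close>, becomes \<open>S\<^bsub>\<tau> - t\<^esub> h\<^sub>t\<^sub>u\<^sub>s\<close> (\<open>delta_frozen\<close>).  An ordinary closed map \<open>k\<close> is exact,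
  with primitive \<open>- k\<^sub>t\<^sub>s\<^sub>0\<close> (\<open>delta_base_germ\<close>).  Sewing subtracts from this primitive the increment of
  a path, which leaves its coboundary unchanged and gains the logarithmic estimate.  Hence
  \<open>r_d S I \<tau> h\<close> is a primitive of the frozen map (\<open>r_d_primitive\<close>).

  What makes all quotient statements easy is that a class modulo closed two-parameter maps is exactly
  the set of continuous primitives of one given map (\<open>qclass_eq_primitives\<close>).  So the class of
  \<open>r_d S I \<tau> h\<close> depends on the frozen map only, and every identity between classes reduces to an
  identity between coboundaries: linearity of the sewing map to linearity of freezing, and
  compatibility of the family to \<open>S\<^bsub>\<tau> - t\<^esub> = S\<^bsub>\<tau> - \<sigma>\<^esub> S\<^bsub>\<sigma> - t\<^esub>\<close> for \<open>t \<le> \<sigma> \<le> \<tau>\<close> (\<open>frozen_transport\<close>), although the chosen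
  representatives themselves need not be compatible.

  The estimate is the product of two bounds.  Freezing each summand of a decomposition of \<open>h\<close> costs a
  factor \<open>M\<close>, the bound of the semigroup on \<open>[0, T]\<close> (\<open>norm1_frozen_le\<close>), and sewing costs \<open>C\<^sub>T\<close>
  uniformly in \<open>\<tau>\<close>.  Continuity follows by linearity.
\<close>

section \<open>Normed subspaces and maps on simplices\<close>

context banach_on
begin

lemma zero_mem: "0 \<in> X"
  and scale_mem: "x \<in> X \<Longrightarrow> c *\<^sub>R x \<in> X"
  and add_mem: "x \<in> X \<Longrightarrow> y \<in> X \<Longrightarrow> x + y \<in> X"
  and diff_mem: "x \<in> X \<Longrightarrow> y \<in> X \<Longrightarrow> x - y \<in> X"
  and minus_mem: "x \<in> X \<Longrightarrow> - x \<in> X"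
  using subspace by (simp_all add: subspace_0 subspace_scale subspace_add subspace_diff subspace_neg)

lemma sum_mem: "(\<And>i. i \<in> J \<Longrightarrow> f i \<in> X) \<Longrightarrow> sum f J \<in> X"
  using subspace by (rule subspace_sum)

lemma norm_0: "N 0 = 0"
  using norm_eq_0 zero_mem by blast

lemma norm_minus: "x \<in> X \<Longrightarrow> N (- x) = N x"
  using norm_scale[of x "-1"] by simp

lemma norm_diff_commute: "x \<in> X \<Longrightarrow> y \<in> X \<Longrightarrow> N (x - y) = N (y - x)"
  using norm_minus[of "y - x"] diff_mem by simp

end

lemma dsimplex_2_iff: "[t, s] \<in> dsimplex 2 \<tau> \<longleftrightarrow> 0 \<le> s \<and> s \<le> t \<and> t \<le> \<tau>"
  by (auto simp: dsimplex_def)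

lemma dsimplex_3_iff: "[t, u, s] \<in> dsimplex 3 \<tau> \<longleftrightarrow> 0 \<le> s \<and> s \<le> u \<and> u \<le> t \<and> t \<le> \<tau>"
  by (auto simp: dsimplex_def)

lemma dsimplex_4_iff:
  "[v, t, u, s] \<in> dsimplex 4 \<tau> \<longleftrightarrow> 0 \<le> s \<and> s \<le> u \<and> u \<le> t \<and> t \<le> v \<and> v \<le> \<tau>"
  by (auto simp: dsimplex_def)

lemma dsimplex_2E:
  assumes "ts \<in> dsimplex 2 \<tau>"
  obtains t s where "ts = [t, s]" "0 \<le> s" "s \<le> t" "t \<le> \<tau>"
  using assms dsimplex_2_iff
  by (auto simp: dsimplex_def numeral_eq_Suc length_Suc_conv)

lemma dsimplex_3E:
  assumes "ts \<in> dsimplex 3 \<tau>"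
  obtains t u s where "ts = [t, u, s]" "0 \<le> s" "s \<le> u" "u \<le> t" "t \<le> \<tau>"
  using assms dsimplex_3_iff
  by (auto simp: dsimplex_def numeral_eq_Suc length_Suc_conv)

lemma dsimplex_4E:
  assumes "ts \<in> dsimplex 4 \<tau>"
  obtains v t u s where "ts = [v, t, u, s]" "0 \<le> s" "s \<le> u" "u \<le> t" "t \<le> v" "v \<le> \<tau>"
  using assms dsimplex_4_iff
  by (auto simp: dsimplex_def numeral_eq_Suc length_Suc_conv)

lemma dsimplex_mono: "\<sigma> \<le> \<tau> \<Longrightarrow> dsimplex n \<sigma> \<subseteq> dsimplex n \<tau>"
  by (auto simp: dsimplex_def)

lemma dsimplex_nthD: "ts \<in> dsimplex n \<tau> \<Longrightarrow> i < n \<Longrightarrow> 0 \<le> ts ! i \<and> ts ! i \<le> \<tau>"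
  by (auto simp: dsimplex_def) (metis atLeastAtMost_iff nth_mem subsetD)+

lemma delta_2:
  "0 \<le> s \<Longrightarrow> s \<le> u \<Longrightarrow> u \<le> t \<Longrightarrow> t \<le> \<tau> \<Longrightarrow>
    delta 2 \<tau> g [t, u, s] = - g [u, s] + g [t, s] - g [t, u]"
  by (simp add: delta_def restr_def dsimplex_3_iff[simplified] numeral_eq_Suc atMost_Suc
      dsimplex_def)

lemma delta_3:
  "0 \<le> s \<Longrightarrow> s \<le> u \<Longrightarrow> u \<le> t \<Longrightarrow> t \<le> v \<Longrightarrow> v \<le> \<tau> \<Longrightarrow>
    delta 3 \<tau> g [v, t, u, s] = - g [t, u, s] + g [v, u, s] - g [v, t, s] + g [v, t, u]"
  by (simp add: delta_def restr_def numeral_eq_Suc atMost_Suc dsimplex_def)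

lemma delta_eq_0_outside: "ts \<notin> dsimplex (Suc n) \<tau> \<Longrightarrow> delta n \<tau> g ts = 0"
  by (simp add: delta_def restr_def)

lemma delta_lincomb:
  "delta n \<tau> (\<lambda>ts. a *\<^sub>R g ts + b *\<^sub>R f ts) = (\<lambda>ts. a *\<^sub>R delta n \<tau> g ts + b *\<^sub>R delta n \<tau> f ts)"
  by (rule ext) (simp add: delta_def restr_def scaleR_sum_right sum.distrib[symmetric]
      scaleR_add_right mult.commute cong: sum.cong)

lemma cont_mapsD: "g \<in> cont_maps X N n \<tau> \<Longrightarrow> ts \<in> dsimplex n \<tau> \<Longrightarrow> g ts \<in> X"
  and cont_maps_outside: "g \<in> cont_maps X N n \<tau> \<Longrightarrow> ts \<notin> dsimplex n \<tau> \<Longrightarrow> g ts = 0"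
  by (auto simp: cont_maps_def)

lemma cont_maps_near:
  assumes "g \<in> cont_maps X N n \<tau>" "ts \<in> dsimplex n \<tau>" "e > 0"
  obtains d where "d > 0"
    "\<And>us. us \<in> dsimplex n \<tau> \<Longrightarrow> (\<And>i. i < n \<Longrightarrow> \<bar>us ! i - ts ! i\<bar> < d) \<Longrightarrow> N (g us - g ts) < e"
proof -
  have "\<exists>d>0. \<forall>us\<in>dsimplex n \<tau>. (\<forall>i<n. \<bar>us ! i - ts ! i\<bar> < d) \<longrightarrow> N (g us - g ts) < e"
    using assms unfolding cont_maps_def by blast
  with that show thesis by blast
qed

lemma cont_mapsI:
  assumes "\<And>ts. ts \<in> dsimplex n \<tau> \<Longrightarrow> g ts \<in> X"
    and "\<And>ts. ts \<notin> dsimplex n \<tau> \<Longrightarrow> g ts = 0"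
    and "\<And>ts e. ts \<in> dsimplex n \<tau> \<Longrightarrow> e > 0 \<Longrightarrow>
      \<exists>d>0. \<forall>us\<in>dsimplex n \<tau>. (\<forall>i<n. \<bar>us ! i - ts ! i\<bar> < d) \<longrightarrow> N (g us - g ts) < e"
  shows "g \<in> cont_maps X N n \<tau>"
  using assms by (auto simp: cont_maps_def)

context banach_on
begin

lemma cont_maps_mem: "g \<in> cont_maps X N n \<tau> \<Longrightarrow> g ts \<in> X"
  by (cases "ts \<in> dsimplex n \<tau>") (auto simp: cont_mapsD cont_maps_outside zero_mem)

lemma cont_maps_lincomb:
  assumes g: "g \<in> cont_maps X N n \<tau>" and f: "f \<in> cont_maps X N n \<tau>"
  shows "(\<lambda>ts. a *\<^sub>R g ts + b *\<^sub>R f ts) \<in> cont_maps X N n \<tau>"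
proof (rule cont_mapsI)
  fix ts and e :: real assume ts: "ts \<in> dsimplex n \<tau>" and e: "e > 0"
  define \<eta> where "\<eta> = e / (\<bar>a\<bar> + \<bar>b\<bar> + 1)"
  have \<eta>: "\<eta> > 0"
    using e by (simp add: \<eta>_def add_nonneg_pos)
  have "(\<bar>a\<bar> + \<bar>b\<bar> + 1) * \<eta> = e"
    unfolding \<eta>_def by (simp add: add_nonneg_pos less_imp_neq[symmetric])
  then have small: "\<bar>a\<bar> * \<eta> + \<bar>b\<bar> * \<eta> < e"
    using \<eta> by (simp add: algebra_simps)
  obtain d where d: "d > 0"
    "\<And>us. us \<in> dsimplex n \<tau> \<Longrightarrow> (\<And>i. i < n \<Longrightarrow> \<bar>us ! i - ts ! i\<bar> < d) \<Longrightarrow> N (g us - g ts) < \<eta>"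
    using cont_maps_near[OF g ts \<eta>] by blast
  obtain d' where d': "d' > 0"
    "\<And>us. us \<in> dsimplex n \<tau> \<Longrightarrow> (\<And>i. i < n \<Longrightarrow> \<bar>us ! i - ts ! i\<bar> < d') \<Longrightarrow> N (f us - f ts) < \<eta>"
    using cont_maps_near[OF f ts \<eta>] by blast
  show "\<exists>d>0. \<forall>us\<in>dsimplex n \<tau>. (\<forall>i<n. \<bar>us ! i - ts ! i\<bar> < d) \<longrightarrow>
      N (a *\<^sub>R g us + b *\<^sub>R f us - (a *\<^sub>R g ts + b *\<^sub>R f ts)) < e"
  proof (intro exI[of _ "min d d'"] conjI ballI impI)
    show "0 < min d d'" using d d' by simp
    fix us assume us: "us \<in> dsimplex n \<tau>" and close: "\<forall>i<n. \<bar>us ! i - ts ! i\<bar> < min d d'"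
    have mem: "g us - g ts \<in> X" "f us - f ts \<in> X"
      using cont_maps_mem[OF g] cont_maps_mem[OF f] diff_mem by auto
    have "N (a *\<^sub>R g us + b *\<^sub>R f us - (a *\<^sub>R g ts + b *\<^sub>R f ts))
        = N (a *\<^sub>R (g us - g ts) + b *\<^sub>R (f us - f ts))"
      by (simp add: algebra_simps)
    also have "\<dots> \<le> \<bar>a\<bar> * N (g us - g ts) + \<bar>b\<bar> * N (f us - f ts)"
      using norm_triangle[OF scale_mem scale_mem] mem by (simp add: norm_scale)
    also have "\<dots> \<le> \<bar>a\<bar> * \<eta> + \<bar>b\<bar> * \<eta>"
      using d(2)[OF us] d'(2)[OF us] close by (intro add_mono mult_left_mono) auto
    finally show "N (a *\<^sub>R g us + b *\<^sub>R f us - (a *\<^sub>R g ts + b *\<^sub>R f ts)) < e"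
      using small by simp
  qed
qed (auto simp: cont_maps_mem[OF g] cont_maps_mem[OF f] scale_mem add_mem
    cont_maps_outside[OF g] cont_maps_outside[OF f])

end

section \<open>The space of three-parameter maps of critical regularity\<close>

text \<open>
  The weights do not depend on the horizon, so a pointwise bound on the smaller simplex suffices.
\<close>

lemma split_norm_le:
  assumes "0 \<le> c" and "\<sigma> \<le> \<tau>"
    and le: "\<And>ts. ts \<in> dsimplex 3 \<sigma> \<Longrightarrow> N (g ts) \<le> c * N (h ts)"
  shows "split_norm N \<rho> \<sigma> g \<le> ennreal c * split_norm N \<rho> \<tau> h"
  unfolding split_norm_def
proof (rule SUP_least)
  fix x assume "x \<in> {(t, u, s). 0 \<le> s \<and> s < u \<and> u < t \<and> t \<le> \<sigma>}"
  then obtain t u s where x: "x = (t, u, s)" and tus: "0 \<le> s" "s < u" "u < t" "t \<le> \<sigma>"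
    by auto
  let ?R = "SUP (t, u, s)\<in>{(t, u, s). 0 \<le> s \<and> s < u \<and> u < t \<and> t \<le> \<tau>}.
    ennreal (N (h [t, u, s]) / (\<bar>t - u\<bar> powr \<rho> * \<bar>u - s\<bar> powr (1 - \<rho>)))"
  let ?w = "\<bar>t - u\<bar> powr \<rho> * \<bar>u - s\<bar> powr (1 - \<rho>)"
  have "N (g [t, u, s]) / ?w \<le> c * (N (h [t, u, s]) / ?w)"
    using divide_right_mono[OF le[of "[t, u, s]"], of ?w] tus by (simp add: dsimplex_3_iff)
  then have "ennreal (N (g [t, u, s]) / ?w) \<le> ennreal c * ennreal (N (h [t, u, s]) / ?w)"
    using \<open>0 \<le> c\<close> by (simp add: ennreal_mult'[symmetric] ennreal_leI)
  also have "\<dots> \<le> ennreal c * ?R"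
    using tus \<open>\<sigma> \<le> \<tau>\<close> by (intro mult_left_mono SUP_upper2[of "(t, u, s)"]) auto
  finally show "(case x of (t, u, s) \<Rightarrow> ennreal (N (g [t, u, s]) /
      (\<bar>t - u\<bar> powr \<rho> * \<bar>u - s\<bar> powr (1 - \<rho>)))) \<le> ennreal c * ?R"
    by (simp add: x)
qed

lemma norm1_le:
  assumes "\<And>j. j < (m::nat) \<Longrightarrow> 0 < \<rho> j \<and> \<rho> j < 1 \<and> H j \<in> cont_maps X N 3 \<tau>"
    and "h = (\<lambda>ts. \<Sum>j<m. H j ts)"
  shows "norm1 X N \<tau> h \<le> (\<Sum>j<m. split_norm N (\<rho> j) \<tau> (H j))"
  unfolding norm1_def using assms
  by (intro Inf_lower CollectI exI[of _ m] exI[of _ \<rho>] exI[of _ H]) auto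

lemma norm1_lessE:
  assumes "norm1 X N \<tau> h < c"
  obtains m \<rho> H where "\<forall>j<m::nat. 0 < \<rho> j \<and> \<rho> j < 1 \<and> H j \<in> cont_maps X N 3 \<tau>"
    "h = (\<lambda>ts. \<Sum>j<m. H j ts)" "(\<Sum>j<m. split_norm N (\<rho> j) \<tau> (H j)) < c"
  using assms unfolding norm1_def Inf_less_iff by blast

text \<open>
  An operation on three-parameter maps that respects finite sums transforms a decomposition of \<open>h\<close>
  into one of the image, with the same exponents; a pointwise bound for the operation on single maps
  therefore passes to the infimum over decompositions.
  The operations of interest are scalar multiplication and freezing.
\<close>

lemma norm1_map_le:
  assumes "0 \<le> c" and "\<sigma> \<le> \<tau>" and finite: "norm1 X N \<tau> h < \<infinity>"
    and cont: "\<And>g. g \<in> cont_maps X N 3 \<tau> \<Longrightarrow> \<Phi> g \<in> cont_maps X N 3 \<sigma>"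
    and sum: "\<And>H m. (\<And>j. j < (m::nat) \<Longrightarrow> H j \<in> cont_maps X N 3 \<tau>) \<Longrightarrow>
      \<Phi> (\<lambda>ts. \<Sum>j<m. H j ts) = (\<lambda>ts. \<Sum>j<m. \<Phi> (H j) ts)"
    and le: "\<And>g ts. g \<in> cont_maps X N 3 \<tau> \<Longrightarrow> ts \<in> dsimplex 3 \<sigma> \<Longrightarrow> N (\<Phi> g ts) \<le> c * N (g ts)"
  shows "norm1 X N \<sigma> (\<Phi> h) \<le> ennreal c * norm1 X N \<tau> h"
proof (rule ennreal_le_epsilon)
  fix e :: real assume e: "e > 0"
  obtain y where y: "norm1 X N \<tau> h = ennreal y" "0 \<le> y"
    using finite by (cases "norm1 X N \<tau> h") auto
  \<comment> \<open>Dividing by \<open>c + 1\<close> rather than by \<open>c\<close> keeps the choice valid when \<open>c = 0\<close>.\<close>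
  define \<eta> where "\<eta> = e / (c + 1)"
  have \<eta>: "\<eta> > 0" and c\<eta>: "c * \<eta> \<le> e"
    using e \<open>0 \<le> c\<close> by (auto simp: \<eta>_def field_simps)
  have "norm1 X N \<tau> h < ennreal (y + \<eta>)"
    using y \<eta> by (simp add: ennreal_lessI)
  then obtain m \<rho> H where
    H: "\<forall>j<m::nat. 0 < \<rho> j \<and> \<rho> j < 1 \<and> H j \<in> cont_maps X N 3 \<tau>"
    and h: "h = (\<lambda>ts. \<Sum>j<m. H j ts)"
    and less: "(\<Sum>j<m. split_norm N (\<rho> j) \<tau> (H j)) < ennreal (y + \<eta>)"
    by (rule norm1_lessE)
  have "norm1 X N \<sigma> (\<Phi> h) \<le> (\<Sum>j<m. split_norm N (\<rho> j) \<sigma> (\<Phi> (H j)))"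
    by (rule norm1_le) (use H cont sum h in auto)
  also have "\<dots> \<le> (\<Sum>j<m. ennreal c * split_norm N (\<rho> j) \<tau> (H j))"
    using H le \<open>0 \<le> c\<close> \<open>\<sigma> \<le> \<tau>\<close> by (intro sum_mono split_norm_le) auto
  also have "\<dots> \<le> ennreal c * ennreal (y + \<eta>)"
    using less by (simp add: sum_distrib_left[symmetric] mult_left_mono less_imp_le)
  also have "\<dots> = ennreal (c * y + c * \<eta>)"
    using \<open>0 \<le> c\<close> y \<eta> by (simp add: ennreal_mult[symmetric] distrib_left)
  also have "\<dots> \<le> ennreal (c * y + e)"
    using c\<eta> by (intro ennreal_leI) simp
  also have "\<dots> = ennreal c * norm1 X N \<tau> h + ennreal e"
    using \<open>0 \<le> c\<close> y e by (simp add: ennreal_mult)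
  finally show "norm1 X N \<sigma> (\<Phi> h) \<le> ennreal c * norm1 X N \<tau> h + ennreal e" .
qed

context banach_on
begin

lemma C1_scale:
  assumes "h \<in> C1 X N \<tau>"
  shows "(\<lambda>ts. a *\<^sub>R h ts) \<in> C1 X N \<tau>"
proof -
  have h: "h \<in> cont_maps X N 3 \<tau>" "norm1 X N \<tau> h < \<infinity>"
    using assms by (auto simp: C1_def)
  have cont: "(\<lambda>ts. a *\<^sub>R g ts) \<in> cont_maps X N 3 \<tau>" if "g \<in> cont_maps X N 3 \<tau>" for g
    using cont_maps_lincomb[OF that that, of a 0] by simp
  have "norm1 X N \<tau> (\<lambda>ts. a *\<^sub>R h ts) \<le> ennreal \<bar>a\<bar> * norm1 X N \<tau> h"
    by (rule norm1_map_le[where \<Phi> = "\<lambda>g ts. a *\<^sub>R g ts"])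
      (use h(2) cont in \<open>auto simp: scaleR_sum_right norm_scale cont_maps_mem\<close>)
  also have "\<dots> < \<infinity>"
    using h(2) by (simp add: ennreal_mult_less_top)
  finally show ?thesis
    using cont[OF h(1)] by (simp add: C1_def)
qed

lemma C1_add:
  assumes h: "h \<in> C1 X N \<tau>" and k: "k \<in> C1 X N \<tau>"
  shows "(\<lambda>ts. h ts + k ts) \<in> C1 X N \<tau>"
proof -
  have cont: "h \<in> cont_maps X N 3 \<tau>" "k \<in> cont_maps X N 3 \<tau>"
    and fin: "norm1 X N \<tau> h < \<infinity>" "norm1 X N \<tau> k < \<infinity>"
    using h k by (auto simp: C1_def)
  obtain m \<rho> H where
    H: "\<forall>j<m::nat. 0 < \<rho> j \<and> \<rho> j < 1 \<and> H j \<in> cont_maps X N 3 \<tau>"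
    and h: "h = (\<lambda>ts. \<Sum>j<m. H j ts)"
    and Hfin: "(\<Sum>j<m. split_norm N (\<rho> j) \<tau> (H j)) < \<infinity>"
    using fin(1) by (rule norm1_lessE)
  obtain n \<sigma> K where
    K: "\<forall>j<n::nat. 0 < \<sigma> j \<and> \<sigma> j < 1 \<and> K j \<in> cont_maps X N 3 \<tau>"
    and k: "k = (\<lambda>ts. \<Sum>j<n. K j ts)"
    and Kfin: "(\<Sum>j<n. split_norm N (\<sigma> j) \<tau> (K j)) < \<infinity>"
    using fin(2) by (rule norm1_lessE)
  \<comment> \<open>A decomposition of the sum lists the summands of \<open>h\<close> and then those of \<open>k\<close>.\<close>
  define \<pi> where "\<pi> j = (if j < m then \<rho> j else \<sigma> (j - m))" for j
  define L where "L j = (if j < m then H j else K (j - m))" for j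
  have sum_append: "(\<Sum>j<m + n. f j) = (\<Sum>j<m. f j) + (\<Sum>j<n. f (m + j))"
    for f :: "nat \<Rightarrow> 'b::comm_monoid_add"
    by (induction n) (simp_all add: add.assoc)
  have "norm1 X N \<tau> (\<lambda>ts. h ts + k ts) \<le> (\<Sum>j<m + n. split_norm N (\<pi> j) \<tau> (L j))"
  proof (rule norm1_le)
    fix j assume "j < m + n"
    then show "0 < \<pi> j \<and> \<pi> j < 1 \<and> L j \<in> cont_maps X N 3 \<tau>"
      using H K by (auto simp: \<pi>_def L_def)
  next
    show "(\<lambda>ts. h ts + k ts) = (\<lambda>ts. \<Sum>j<m + n. L j ts)"
      by (simp add: sum_append h k L_def)
  qed
  also have "\<dots> < \<infinity>"
    using Hfin Kfin by (simp add: sum_append \<pi>_def L_def)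
  finally show ?thesis
    using cont_maps_lincomb[OF cont, of 1 1] by (simp add: C1_def)
qed

end

section \<open>Cohomology classes of two-parameter maps\<close>

definition primitives ::
  "'v::real_vector set \<Rightarrow> ('v \<Rightarrow> real) \<Rightarrow> real \<Rightarrow> (real list \<Rightarrow> 'v) \<Rightarrow> (real list \<Rightarrow> 'v) set" where
  "primitives X N \<tau> k = {r \<in> cont_maps X N 2 \<tau>. delta 2 \<tau> r = k}"

context banach_on
begin

text \<open>
  Two continuous maps differ by a closed one iff their coboundaries agree, so a class is a fibre of
  \<open>delta 2 \<tau>\<close>.  This turns identities between classes into identities between coboundaries.
\<close>

lemma qclass_eq_primitives:
  assumes "r \<in> cont_maps X N 2 \<tau>"
  shows "qclass X N \<tau> r = primitives X N \<tau> (delta 2 \<tau> r)"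
proof -
  have "(\<lambda>ts. r' ts - r ts) \<in> ZC X N \<tau> \<longleftrightarrow> delta 2 \<tau> r' = delta 2 \<tau> r"
    if "r' \<in> cont_maps X N 2 \<tau>" for r'
    using cont_maps_lincomb[OF that assms, of 1 "-1"] delta_lincomb[of 2 \<tau> 1 r' "-1" r]
    by (auto simp: ZC_def fun_eq_iff)
  then show ?thesis
    by (auto simp: qclass_def primitives_def)
qed

lemma qclass_eq_primitivesI:
  "r \<in> primitives X N \<tau> k \<Longrightarrow> qclass X N \<tau> r = primitives X N \<tau> k"
  by (auto simp: primitives_def qclass_eq_primitives)

lemma qadd_primitives:
  assumes "primitives X N \<tau> k \<noteq> {}" and "primitives X N \<tau> l \<noteq> {}"
  shows "qadd X N \<tau> (primitives X N \<tau> k) (primitives X N \<tau> l)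
    = primitives X N \<tau> (\<lambda>ts. k ts + l ts)"
proof -
  have "qclass X N \<tau> (\<lambda>ts. r ts + q ts) = primitives X N \<tau> (\<lambda>ts. k ts + l ts)"
    if "r \<in> primitives X N \<tau> k" "q \<in> primitives X N \<tau> l" for r q
  proof (rule qclass_eq_primitivesI)
    show "(\<lambda>ts. r ts + q ts) \<in> primitives X N \<tau> (\<lambda>ts. k ts + l ts)"
      using that cont_maps_lincomb[of r 2 \<tau> q 1 1] delta_lincomb[of 2 \<tau> 1 r 1 q]
      by (simp add: primitives_def)
  qed
  with assms show ?thesis
    unfolding qadd_def by auto
qed

lemma qscale_primitives:
  assumes "primitives X N \<tau> k \<noteq> {}"
  shows "qscale X N \<tau> a (primitives X N \<tau> k) = primitives X N \<tau> (\<lambda>ts. a *\<^sub>R k ts)"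
proof -
  have "qclass X N \<tau> (\<lambda>ts. a *\<^sub>R r ts) = primitives X N \<tau> (\<lambda>ts. a *\<^sub>R k ts)"
    if "r \<in> primitives X N \<tau> k" for r
  proof (rule qclass_eq_primitivesI)
    show "(\<lambda>ts. a *\<^sub>R r ts) \<in> primitives X N \<tau> (\<lambda>ts. a *\<^sub>R k ts)"
      using that cont_maps_lincomb[of r 2 \<tau> r a 0] delta_lincomb[of 2 \<tau> a r 0 r]
      by (simp add: primitives_def)
  qed
  with assms show ?thesis
    unfolding qscale_def by auto
qed

lemma base_germ_cont_maps:
  assumes k: "k \<in> cont_maps X N 3 \<tau>" and "0 \<le> \<tau>"
  shows "base_germ \<tau> k \<in> cont_maps X N 2 \<tau>"
proof (rule cont_mapsI)
  fix ts and e :: real assume ts: "ts \<in> dsimplex 2 \<tau>" and e: "e > 0"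
  have ext: "us @ [0] \<in> dsimplex 3 \<tau>" if "us \<in> dsimplex 2 \<tau>" for us
    using that \<open>0 \<le> \<tau>\<close> by (auto elim!: dsimplex_2E simp: dsimplex_3_iff)
  obtain d where d: "d > 0" "\<And>us. us \<in> dsimplex 3 \<tau> \<Longrightarrow>
      (\<And>i. i < 3 \<Longrightarrow> \<bar>us ! i - (ts @ [0]) ! i\<bar> < d) \<Longrightarrow> N (k us - k (ts @ [0])) < e"
    using cont_maps_near[OF k ext[OF ts] e] by blast
  show "\<exists>d>0. \<forall>us\<in>dsimplex 2 \<tau>. (\<forall>i<2. \<bar>us ! i - ts ! i\<bar> < d) \<longrightarrow>
      N (base_germ \<tau> k us - base_germ \<tau> k ts) < e"
  proof (intro exI[of _ d] conjI ballI impI)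
    fix us assume us: "us \<in> dsimplex 2 \<tau>" and close: "\<forall>i<2. \<bar>us ! i - ts ! i\<bar> < d"
    have "\<bar>(us @ [0]) ! i - (ts @ [0]) ! i\<bar> < d" if "i < 3" for i
      using that close us ts d(1) by (cases "i < 2") (auto simp: nth_append dsimplex_def)
    then have "N (k (us @ [0]) - k (ts @ [0])) < e"
      using d(2)[OF ext[OF us]] by blast
    then show "N (base_germ \<tau> k us - base_germ \<tau> k ts) < e"
      using us ts norm_diff_commute[of "k (us @ [0])" "k (ts @ [0])"] cont_maps_mem[OF k]
      by (simp add: base_germ_def restr_def)
  qed (use d in simp)
qed (auto simp: base_germ_def restr_def intro: minus_mem cont_maps_mem[OF k])

text \<open>
  The cone over the base point \<open>0\<close> gives an explicit primitive: in the cocycle identity at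
  \<open>(t, u, s, 0)\<close>, the three terms ending in \<open>0\<close> are the coboundary of the germ and the fourth is
  \<open>k\<^sub>t\<^sub>u\<^sub>s\<close>.
\<close>

lemma delta_base_germ:
  assumes k: "k \<in> cont_maps X N 3 \<tau>" and closed: "delta 3 \<tau> k = (\<lambda>_. 0)" and "0 \<le> \<tau>"
  shows "delta 2 \<tau> (base_germ \<tau> k) = k"
proof
  fix ts
  show "delta 2 \<tau> (base_germ \<tau> k) ts = k ts"
  proof (cases "ts \<in> dsimplex 3 \<tau>")
    case True
    then obtain t u s where ts: "ts = [t, u, s]" "0 \<le> s" "s \<le> u" "u \<le> t" "t \<le> \<tau>"
      by (rule dsimplex_3E)
    have "delta 3 \<tau> k [t, u, s, 0] = 0"
      using closed by simp
    then have "k [t, u, s] = k [u, s, 0] - k [t, s, 0] + k [t, u, 0]"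
      using ts by (simp add: delta_3 algebra_simps)
    then show ?thesis
      using ts by (simp add: delta_2 base_germ_def restr_def dsimplex_2_iff)
  qed (use delta_eq_0_outside[of ts 2] cont_maps_outside[OF k] in simp)
qed

lemma base_germ_A1:
  assumes "k \<in> ZC1 X N \<tau>" and "0 \<le> \<tau>"
  shows "base_germ \<tau> k \<in> A1 X N \<tau>"
  using assms base_germ_cont_maps delta_base_germ by (auto simp: A1_def ZC1_def C1_def)

end


section \<open>Freezing with a semigroup\<close>

text \<open>
  The operator norm is a supremum over the unit ball; homogeneity extends its bound to all vectors.
\<close>

lemma (in banach_on) operator_norm_bound:
  assumes lin: "bounded_operator_on X N f" and le: "operator_norm X N f \<le> ennreal M"
    and "0 \<le> M" and x: "x \<in> X"
  shows "N (f x) \<le> M * N x"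
proof (cases "x = 0")
  case True
  have "f 0 = 0"
    using lin x scaleR_zero_left unfolding bounded_operator_on_def by metis
  with True show ?thesis
    by (simp add: norm_0)
next
  case False
  then have pos: "N x > 0"
    using x norm_nonneg[OF x] norm_eq_0[OF x] by simp
  let ?y = "(1 / N x) *\<^sub>R x"
  have y: "?y \<in> X" "N ?y \<le> 1"
    using x pos by (simp_all add: scale_mem norm_scale)
  then have "ennreal (N (f ?y)) \<le> operator_norm X N f"
    unfolding operator_norm_def by (intro SUP_upper) auto
  then have "N (f ?y) \<le> M"
    using le \<open>0 \<le> M\<close> by (meson ennreal_le_iff order_trans)
  moreover have "N (f ?y) = N (f x) / N x"
    using lin x pos by (simp add: bounded_operator_on_def norm_scale)
  ultimately show ?thesis
    using pos by (simp add: field_simps)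
qed

locale bounded_C0_semigroup = C0_semigroup_on X N S
  for X :: "'v::real_vector set" and N :: "'v \<Rightarrow> real" and S :: "real \<Rightarrow> 'v \<Rightarrow> 'v" +
  fixes T M :: real
  assumes M_nonneg: "0 \<le> M"
    and uniform_bound: "0 \<le> r \<Longrightarrow> r \<le> T \<Longrightarrow> x \<in> X \<Longrightarrow> N (S r x) \<le> M * N x"
begin

lemma S_mem: "0 \<le> r \<Longrightarrow> x \<in> X \<Longrightarrow> S r x \<in> X"
  and S_add: "0 \<le> r \<Longrightarrow> x \<in> X \<Longrightarrow> y \<in> X \<Longrightarrow> S r (x + y) = S r x + S r y"
  and S_scale: "0 \<le> r \<Longrightarrow> x \<in> X \<Longrightarrow> S r (c *\<^sub>R x) = c *\<^sub>R S r x"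
  using bounded[of r] by (auto simp: bounded_operator_on_def)

lemma S_0: "0 \<le> r \<Longrightarrow> S r 0 = 0"
  using S_scale[OF _ zero_mem, of r 0] by simp

lemma S_minus: "0 \<le> r \<Longrightarrow> x \<in> X \<Longrightarrow> S r (- x) = - S r x"
  using S_scale[of r x "-1"] by simp

lemma S_diff: "0 \<le> r \<Longrightarrow> x \<in> X \<Longrightarrow> y \<in> X \<Longrightarrow> S r (x - y) = S r x - S r y"
  using S_add[of r x "- y"] by (simp add: S_minus minus_mem)

lemma S_sum:
  assumes "0 \<le> r" and "\<And>j. j < (m::nat) \<Longrightarrow> f j \<in> X"
  shows "S r (\<Sum>j<m. f j) = (\<Sum>j<m. S r (f j))"
  using assms(2)
proof (induction m)
  case 0
  then show ?case using assms(1) by (simp add: S_0)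
next
  case (Suc m)
  then have "sum f {..<m} \<in> X" "f m \<in> X"
    by (auto intro: sum_mem)
  with Suc assms(1) show ?case by (simp add: S_add)
qed

text \<open>
  Right continuity at time \<open>0\<close> spreads to uniform continuity of orbits on \<open>[0, T]\<close>: for \<open>a < b\<close> one has
  \<open>S\<^sub>b x - S\<^sub>a x = S\<^sub>a (S\<^bsub>b - a\<^esub> x - x)\<close>, and \<open>S\<^sub>a\<close> is bounded uniformly.
\<close>

lemma orbit_near:
  assumes x: "x \<in> X" and e: "e > 0"
  obtains d where "d > 0"
    "\<And>a b. 0 \<le> a \<Longrightarrow> a \<le> T \<Longrightarrow> 0 \<le> b \<Longrightarrow> b \<le> T \<Longrightarrow> \<bar>b - a\<bar> < d \<Longrightarrow> N (S b x - S a x) < e"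
proof -
  define \<eta> where "\<eta> = e / (M + 1)"
  have \<eta>: "\<eta> > 0" and small: "M * \<eta> < e"
    using e M_nonneg by (auto simp: \<eta>_def field_simps)
  have "eventually (\<lambda>t. N (S t x - x) < \<eta>) (at_right 0)"
    using strongly_continuous[OF x] \<eta> by (rule order_tendstoD)
  then obtain d where d: "d > 0" "\<And>t. 0 < t \<Longrightarrow> t < d \<Longrightarrow> N (S t x - x) < \<eta>"
    by (auto simp: eventually_at_right_field)
  have ordered: "N (S b x - S a x) < e" if "0 \<le> a" "a < b" "b \<le> T" "b - a < d" for a b
  proof -
    have "S b x - S a x = S a (S (b - a) x - x)"
      using add[of a "b - a" x] that x by (simp add: S_diff S_mem)
    then have "N (S b x - S a x) \<le> M * N (S (b - a) x - x)"
      using uniform_bound[of a "S (b - a) x - x"] that x by (simp add: S_mem diff_mem)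
    also have "\<dots> \<le> M * \<eta>"
      using d(2)[of "b - a"] that M_nonneg by (intro mult_left_mono) auto
    finally show ?thesis
      using small by simp
  qed
  have "N (S b x - S a x) < e"
    if "0 \<le> a" "a \<le> T" "0 \<le> b" "b \<le> T" "\<bar>b - a\<bar> < d" for a b
  proof (cases a b rule: linorder_cases)
    case greater
    then show ?thesis
      using ordered[of b a] that norm_diff_commute[of "S b x" "S a x"] x by (simp add: S_mem)
  qed (use ordered[of a b] that e in \<open>auto simp: norm_0\<close>)
  with d(1) that show thesis by blast
qed

text \<open>
  A strongly continuous semigroup need not be continuous in operator norm, so joint continuity comes
  from splitting \<open>S\<^sub>b y - S\<^sub>a x = S\<^sub>b (y - x) + (S\<^sub>b x - S\<^sub>a x)\<close>: the uniform bound controls the first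
  part, the orbit of the fixed vector \<open>x\<close> the second.  The times \<open>\<phi>\<close> cover both freezing, where
  \<open>\<phi> ts = \<tau> - ts ! 0\<close>, and transport by a constant time.
\<close>

lemma semigroup_cont_maps:
  assumes g: "g \<in> cont_maps X N n \<tau>" and "\<sigma> \<le> \<tau>"
    and range: "\<And>ts. ts \<in> dsimplex n \<sigma> \<Longrightarrow> 0 \<le> \<phi> ts \<and> \<phi> ts \<le> T"
    and \<phi>: "\<And>ts us d. ts \<in> dsimplex n \<sigma> \<Longrightarrow> us \<in> dsimplex n \<sigma> \<Longrightarrow> 0 < d \<Longrightarrow>
      \<forall>i<n. \<bar>us ! i - ts ! i\<bar> < d \<Longrightarrow> \<bar>\<phi> us - \<phi> ts\<bar> < d"
  shows "restr n \<sigma> (\<lambda>ts. S (\<phi> ts) (g ts)) \<in> cont_maps X N n \<sigma>"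
proof (rule cont_mapsI)
  fix ts and e :: real assume ts: "ts \<in> dsimplex n \<sigma>" and e: "e > 0"
  have sub: "us \<in> dsimplex n \<tau>" if "us \<in> dsimplex n \<sigma>" for us
    using that dsimplex_mono[OF \<open>\<sigma> \<le> \<tau>\<close>] by blast
  note mem = cont_maps_mem[OF g]
  define \<eta> where "\<eta> = e / (2 * (M + 1))"
  have \<eta>: "\<eta> > 0" and small: "M * \<eta> \<le> e / 2"
    using e M_nonneg by (auto simp: \<eta>_def field_simps)
  obtain d where d: "d > 0" "\<And>us. us \<in> dsimplex n \<tau> \<Longrightarrow>
      (\<And>i. i < n \<Longrightarrow> \<bar>us ! i - ts ! i\<bar> < d) \<Longrightarrow> N (g us - g ts) < \<eta>"
    using cont_maps_near[OF g sub[OF ts] \<eta>] by blast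
  have "e / 2 > 0" using e by simp
  then obtain d' where d': "d' > 0" "\<And>a b. 0 \<le> a \<Longrightarrow> a \<le> T \<Longrightarrow> 0 \<le> b \<Longrightarrow> b \<le> T \<Longrightarrow>
      \<bar>b - a\<bar> < d' \<Longrightarrow> N (S b (g ts) - S a (g ts)) < e / 2"
    using orbit_near[OF mem] by blast
  let ?f = "restr n \<sigma> (\<lambda>ts. S (\<phi> ts) (g ts))"
  show "\<exists>d>0. \<forall>us\<in>dsimplex n \<sigma>. (\<forall>i<n. \<bar>us ! i - ts ! i\<bar> < d) \<longrightarrow> N (?f us - ?f ts) < e"
  proof (intro exI[of _ "min d d'"] conjI ballI impI)
    fix us assume us: "us \<in> dsimplex n \<sigma>" and close: "\<forall>i<n. \<bar>us ! i - ts ! i\<bar> < min d d'"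
    have r: "0 \<le> \<phi> us" "\<phi> us \<le> T" "0 \<le> \<phi> ts" "\<phi> ts \<le> T"
      using range us ts by auto
    have "\<bar>\<phi> us - \<phi> ts\<bar> < min d d'"
      using \<phi>[OF ts us _ close] d d' by simp
    then have orbit: "N (S (\<phi> us) (g ts) - S (\<phi> ts) (g ts)) < e / 2"
      using d'(2) r by simp
    have "N (g us - g ts) < \<eta>"
      using d(2)[OF sub[OF us]] close by simp
    then have "M * N (g us - g ts) \<le> e / 2"
      using small mult_left_mono[of "N (g us - g ts)" \<eta> M] M_nonneg by simp
    then have map: "N (S (\<phi> us) (g us - g ts)) \<le> e / 2"
      using uniform_bound[OF r(1,2), of "g us - g ts"] mem diff_mem by fastforce
    \<comment> \<open>Only the value at the fixed point \<open>ts\<close> is moved along its orbit.\<close>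
    have "?f us - ?f ts = S (\<phi> us) (g us - g ts) + (S (\<phi> us) (g ts) - S (\<phi> ts) (g ts))"
      using us ts r mem by (simp add: restr_def S_diff)
    then have "N (?f us - ?f ts)
        \<le> N (S (\<phi> us) (g us - g ts)) + N (S (\<phi> us) (g ts) - S (\<phi> ts) (g ts))"
      using r mem by (simp add: norm_triangle S_mem diff_mem)
    with map orbit show "N (?f us - ?f ts) < e" by simp
  qed (use d d' in simp)
qed (use range in \<open>auto simp: restr_def intro!: S_mem cont_maps_mem[OF g]\<close>)

lemma semigroup_const_cont_maps:
  assumes "g \<in> cont_maps X N n \<tau>" and "\<sigma> \<le> \<tau>" and "0 \<le> c" "c \<le> T"
  shows "restr n \<sigma> (\<lambda>ts. S c (g ts)) \<in> cont_maps X N n \<sigma>"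
  by (rule semigroup_cont_maps) (use assms in auto)

text \<open>
  Plain restriction is transport by the time \<open>0\<close>.
\<close>

lemma restr_cont_maps:
  assumes g: "g \<in> cont_maps X N n \<tau>" and "\<sigma> \<le> \<tau>" and "0 \<le> T"
  shows "restr n \<sigma> g \<in> cont_maps X N n \<sigma>"
  using semigroup_const_cont_maps[OF g \<open>\<sigma> \<le> \<tau>\<close> order_refl \<open>0 \<le> T\<close>] zero cont_maps_mem[OF g] by simp

lemma frozen_cont_maps:
  assumes "h \<in> cont_maps X N 3 T" and "0 \<le> \<tau>" "\<tau> \<le> T"
  shows "frozen S \<tau> h \<in> cont_maps X N 3 \<tau>"
  unfolding frozen_def
proof (rule semigroup_cont_maps)
  fix ts assume "ts \<in> dsimplex 3 \<tau>"
  then show "0 \<le> \<tau> - ts ! 0 \<and> \<tau> - ts ! 0 \<le> T"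
    using dsimplex_nthD[of ts 3 \<tau> 0] assms by simp
qed (use assms in \<open>auto simp: abs_minus_commute\<close>)

lemma frozen_3:
  "0 \<le> s \<Longrightarrow> s \<le> u \<Longrightarrow> u \<le> t \<Longrightarrow> t \<le> \<tau> \<Longrightarrow> frozen S \<tau> h [t, u, s] = S (\<tau> - t) (h [t, u, s])"
  by (simp add: frozen_def restr_def dsimplex_3_iff)

lemma frozen_outside: "ts \<notin> dsimplex 3 \<tau> \<Longrightarrow> frozen S \<tau> h ts = 0"
  by (simp add: frozen_def restr_def)

lemma frozen_lincomb:
  assumes "h \<in> cont_maps X N 3 T" and "k \<in> cont_maps X N 3 T"
  shows "frozen S \<tau> (\<lambda>ts. a *\<^sub>R h ts + b *\<^sub>R k ts)
    = (\<lambda>ts. a *\<^sub>R frozen S \<tau> h ts + b *\<^sub>R frozen S \<tau> k ts)"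
proof
  fix ts show "frozen S \<tau> (\<lambda>ts. a *\<^sub>R h ts + b *\<^sub>R k ts) ts
      = a *\<^sub>R frozen S \<tau> h ts + b *\<^sub>R frozen S \<tau> k ts"
    by (cases "ts \<in> dsimplex 3 \<tau>")
      (auto elim!: dsimplex_3E
        simp: frozen_3 frozen_outside S_add S_scale scale_mem cont_maps_mem[OF assms(1)]
          cont_maps_mem[OF assms(2)])
qed

lemma frozen_sum:
  assumes "\<And>j. j < (m::nat) \<Longrightarrow> H j \<in> cont_maps X N 3 T"
  shows "frozen S \<tau> (\<lambda>ts. \<Sum>j<m. H j ts) = (\<lambda>ts. \<Sum>j<m. frozen S \<tau> (H j) ts)"
proof
  fix ts show "frozen S \<tau> (\<lambda>ts. \<Sum>j<m. H j ts) ts = (\<Sum>j<m. frozen S \<tau> (H j) ts)"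
    by (cases "ts \<in> dsimplex 3 \<tau>")
      (auto elim!: dsimplex_3E simp: frozen_3 frozen_outside
        intro!: S_sum cont_maps_mem[OF assms])
qed

lemma norm1_frozen_le:
  assumes "h \<in> C1 X N T" and "0 \<le> \<tau>" "\<tau> \<le> T"
  shows "norm1 X N \<tau> (frozen S \<tau> h) \<le> ennreal M * norm1 X N T h"
proof (rule norm1_map_le)
  fix g ts assume g: "g \<in> cont_maps X N 3 T" and "ts \<in> dsimplex 3 \<tau>"
  then show "N (frozen S \<tau> g ts) \<le> M * N (g ts)"
    using assms(2,3)
    by (auto elim!: dsimplex_3E simp: frozen_3 intro!: uniform_bound cont_maps_mem[OF g])
qed (use assms in \<open>auto simp: M_nonneg C1_def frozen_cont_maps frozen_sum\<close>)

lemma delta_hat_lincomb: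
  assumes "h \<in> cont_maps X N 3 T" and "k \<in> cont_maps X N 3 T"
  shows "delta_hat S 3 T (\<lambda>ts. a *\<^sub>R h ts + b *\<^sub>R k ts)
    = (\<lambda>ts. a *\<^sub>R delta_hat S 3 T h ts + b *\<^sub>R delta_hat S 3 T k ts)"
proof
  fix ts show "delta_hat S 3 T (\<lambda>ts. a *\<^sub>R h ts + b *\<^sub>R k ts) ts
      = a *\<^sub>R delta_hat S 3 T h ts + b *\<^sub>R delta_hat S 3 T k ts"
    by (cases "ts \<in> dsimplex 4 T")
      (auto elim!: dsimplex_4E simp: delta_hat_def restr_def delta_lincomb S_add S_scale
        scale_mem cont_maps_mem[OF assms(1)] cont_maps_mem[OF assms(2)] algebra_simps)
qed

lemma ZC1_hat_lincomb:
  assumes h: "h \<in> ZC1_hat X N S T" and k: "k \<in> ZC1_hat X N S T"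
  shows "(\<lambda>ts. a *\<^sub>R h ts + b *\<^sub>R k ts) \<in> ZC1_hat X N S T"
proof -
  have "h \<in> C1 X N T" "k \<in> C1 X N T"
    using h k by (auto simp: ZC1_hat_def)
  then have "(\<lambda>ts. a *\<^sub>R h ts + b *\<^sub>R k ts) \<in> C1 X N T"
    by (intro C1_add C1_scale)
  then show ?thesis
    using h k delta_hat_lincomb[of h k a b] by (simp add: ZC1_hat_def C1_def)
qed

text \<open>
  Freezing intertwines the twisted and the ordinary coboundary: \<open>S\<^bsub>\<tau> - v\<^esub>\<close> applied to the twisted
  cocycle identity absorbs the factor \<open>S\<^bsub>v - t\<^esub>\<close> by the semigroup law.
\<close>

lemma delta_frozen:
  assumes h: "h \<in> ZC1_hat X N S T" and \<tau>: "0 \<le> \<tau>" "\<tau> \<le> T"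
  shows "delta 3 \<tau> (frozen S \<tau> h) = (\<lambda>_. 0)"
proof
  fix ts
  have cont: "h \<in> cont_maps X N 3 T" and closed: "delta_hat S 3 T h = (\<lambda>_. 0)"
    using h by (auto simp: ZC1_hat_def C1_def)
  note mem = cont_maps_mem[OF cont]
  show "delta 3 \<tau> (frozen S \<tau> h) ts = 0"
  proof (cases "ts \<in> dsimplex 4 \<tau>")
    case True
    then obtain v t u s where ts: "ts = [v, t, u, s]" "0 \<le> s" "s \<le> u" "u \<le> t" "t \<le> v" "v \<le> \<tau>"
      by (rule dsimplex_4E)
    have "delta_hat S 3 T h [v, t, u, s] = 0"
      using closed by simp
    then have twisted: "S (v - t) (h [t, u, s]) = h [v, u, s] - h [v, t, s] + h [v, t, u]"
      using ts \<tau> by (simp add: delta_hat_def restr_def dsimplex_4_iff delta_3 algebra_simps)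
    have "S (\<tau> - t) (h [t, u, s]) = S (\<tau> - v) (S (v - t) (h [t, u, s]))"
      using add[of "\<tau> - v" "v - t" "h [t, u, s]"] ts mem by simp
    also have "\<dots> = S (\<tau> - v) (h [v, u, s]) - S (\<tau> - v) (h [v, t, s]) + S (\<tau> - v) (h [v, t, u])"
      using ts mem by (simp add: twisted S_add S_diff diff_mem)
    finally show ?thesis
      using ts by (simp add: delta_3 frozen_3)
  qed (use delta_eq_0_outside[of ts 3] in simp)
qed

lemma frozen_ZC1:
  assumes h: "h \<in> ZC1_hat X N S T" and \<tau>: "0 \<le> \<tau>" "\<tau> \<le> T"
  shows "frozen S \<tau> h \<in> ZC1 X N \<tau>"
proof -
  have C1: "h \<in> C1 X N T"
    using h by (simp add: ZC1_hat_def)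
  have "ennreal M * norm1 X N T h < \<infinity>"
    using C1 by (simp add: C1_def ennreal_mult_less_top)
  then have "norm1 X N \<tau> (frozen S \<tau> h) < \<infinity>"
    using norm1_frozen_le[OF C1 \<tau>] by (rule le_less_trans[rotated])
  then show ?thesis
    using C1 frozen_cont_maps[OF _ \<tau>] delta_frozen[OF h \<tau>] by (simp add: ZC1_def C1_def)
qed

end

section \<open>The sewing map into compatible families of classes\<close>

context bounded_C0_semigroup
begin

text \<open>
  Restriction and transport commute with the coboundary, so each sends the class of primitives of \<open>k\<close>
  to the class of primitives of the restricted or transported \<open>k\<close>.  Nonemptiness matters because the
  operations on classes are unions over representatives.
\<close>

lemma Res_primitives:
  assumes nonempty: "primitives X N \<tau> k \<noteq> {}" and "\<sigma> \<le> \<tau>" and "0 \<le> T"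
  shows "Res X N \<sigma> (primitives X N \<tau> k) = primitives X N \<sigma> (restr 3 \<sigma> k)"
proof -
  have "qclass X N \<sigma> (restr 2 \<sigma> r) = primitives X N \<sigma> (restr 3 \<sigma> k)"
    if r: "r \<in> primitives X N \<tau> k" for r
  proof (rule qclass_eq_primitivesI)
    have cont: "r \<in> cont_maps X N 2 \<tau>" and k: "k = delta 2 \<tau> r"
      using r by (auto simp: primitives_def)
    have "delta 2 \<sigma> (restr 2 \<sigma> r) ts = restr 3 \<sigma> k ts" for ts
      using delta_eq_0_outside[of ts 2] \<open>\<sigma> \<le> \<tau>\<close>
      by (cases "ts \<in> dsimplex 3 \<sigma>")
        (auto elim!: dsimplex_3E
          simp: delta_2 restr_def k dsimplex_2_iff dsimplex_3_iff)
    then show "restr 2 \<sigma> r \<in> primitives X N \<sigma> (restr 3 \<sigma> k)"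
      using restr_cont_maps[OF cont \<open>\<sigma> \<le> \<tau>\<close> \<open>0 \<le> T\<close>] by (auto simp: primitives_def)
  qed
  with nonempty show ?thesis
    unfolding Res_def by auto
qed

lemma Trans_primitives:
  assumes nonempty: "primitives X N \<sigma> k \<noteq> {}" and "\<sigma> \<le> \<tau>" and "\<tau> \<le> T" and "0 \<le> \<sigma>"
  shows "Trans X N S \<tau> \<sigma> (primitives X N \<sigma> k)
    = primitives X N \<sigma> (restr 3 \<sigma> (\<lambda>ts. S (\<tau> - \<sigma>) (k ts)))"
proof -
  let ?k = "restr 3 \<sigma> (\<lambda>ts. S (\<tau> - \<sigma>) (k ts))"
  have "qclass X N \<sigma> (restr 2 \<sigma> (\<lambda>ts. S (\<tau> - \<sigma>) (q ts))) = primitives X N \<sigma> ?k"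
    if q: "q \<in> primitives X N \<sigma> k" for q
  proof (rule qclass_eq_primitivesI)
    have cont: "q \<in> cont_maps X N 2 \<sigma>" and k: "k = delta 2 \<sigma> q"
      using q by (auto simp: primitives_def)
    note mem = cont_maps_mem[OF cont]
    have "delta 2 \<sigma> (restr 2 \<sigma> (\<lambda>ts. S (\<tau> - \<sigma>) (q ts))) ts = ?k ts" for ts
      using delta_eq_0_outside[of ts 2] \<open>\<sigma> \<le> \<tau>\<close>
      by (cases "ts \<in> dsimplex 3 \<sigma>")
        (auto elim!: dsimplex_3E simp: delta_2 restr_def k dsimplex_2_iff dsimplex_3_iff mem
          minus_mem diff_mem add_mem S_add S_diff S_minus)
    then show "restr 2 \<sigma> (\<lambda>ts. S (\<tau> - \<sigma>) (q ts)) \<in> primitives X N \<sigma> ?k"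
      using semigroup_const_cont_maps[OF cont order_refl, of "\<tau> - \<sigma>"] assms
      by (auto simp: primitives_def)
  qed
  with nonempty show ?thesis
    unfolding Trans_def by auto
qed

text \<open>
  Freezing at a later time is freezing at \<open>\<sigma>\<close> followed by the flow over \<open>[\<sigma>, \<tau>]\<close>.  Together with the
  behaviour of classes under restriction and transport, this is the compatibility of the family.
\<close>

lemma frozen_transport:
  assumes cont: "h \<in> cont_maps X N 3 T" and "\<sigma> \<le> \<tau>"
  shows "restr 3 \<sigma> (frozen S \<tau> h) = restr 3 \<sigma> (\<lambda>ts. S (\<tau> - \<sigma>) (frozen S \<sigma> h ts))"
proof
  fix ts
  have "S (\<tau> - t) x = S (\<tau> - \<sigma>) (S (\<sigma> - t) x)" if "t \<le> \<sigma>" "x \<in> X" for t x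
    using add[of "\<tau> - \<sigma>" "\<sigma> - t" x] that \<open>\<sigma> \<le> \<tau>\<close> by simp
  then show "restr 3 \<sigma> (frozen S \<tau> h) ts = restr 3 \<sigma> (\<lambda>ts. S (\<tau> - \<sigma>) (frozen S \<sigma> h ts)) ts"
    using \<open>\<sigma> \<le> \<tau>\<close> cont_maps_mem[OF cont]
    by (cases "ts \<in> dsimplex 3 \<sigma>")
      (auto elim!: dsimplex_3E simp: restr_def frozen_3 dsimplex_3_iff)
qed

end

locale frozen_sewing = bounded_C0_semigroup X N S T M + dyadic_sewing X N T I C\<^sub>T
  for X :: "'v::real_vector set" and N :: "'v \<Rightarrow> real" and S :: "real \<Rightarrow> 'v \<Rightarrow> 'v"
    and T M :: real and I :: "real \<Rightarrow> (real list \<Rightarrow> 'v) \<Rightarrow> real list \<Rightarrow> 'v" and C\<^sub>T :: real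
begin

lemma r_d_C_log:
  assumes "h \<in> ZC1_hat X N S T" and "0 \<le> \<tau>" "\<tau> \<le> T"
  shows "r_d S I \<tau> h \<in> C_log X N \<tau>"
  unfolding r_d_def Lambda_d_def
  using assms by (intro remainder_log base_germ_A1 frozen_ZC1)

text \<open>
  Sewing changes the germ of the frozen map by the increment of a path only, and the germ is a
  primitive of the frozen map.
\<close>

lemma r_d_primitive:
  assumes h: "h \<in> ZC1_hat X N S T" and \<tau>: "0 \<le> \<tau>" "\<tau> \<le> T"
  shows "r_d S I \<tau> h \<in> primitives X N \<tau> (frozen S \<tau> h)"
proof -
  have ZC1: "frozen S \<tau> h \<in> ZC1 X N \<tau>"
    using frozen_ZC1[OF h \<tau>] .
  then have "delta 2 \<tau> (r_d S I \<tau> h) = frozen S \<tau> h"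
    unfolding r_d_def Lambda_d_def
    using delta_remainder[OF \<tau> base_germ_A1] delta_base_germ[of "frozen S \<tau> h" \<tau>] \<tau>
    by (simp add: ZC1_def C1_def)
  then show ?thesis
    using r_d_C_log[OF h \<tau>] by (simp add: primitives_def C_log_def)
qed

lemma Lambda_q_eq_primitives:
  assumes "h \<in> ZC1_hat X N S T" and "0 \<le> \<tau>" "\<tau> \<le> T"
  shows "Lambda_q X N S I T h \<tau> = primitives X N \<tau> (frozen S \<tau> h)"
  using qclass_eq_primitivesI[OF r_d_primitive[OF assms]] assms by (simp add: Lambda_q_def)

text \<open>
  The representative \<open>r_d S I \<tau> h\<close> already satisfies the bound: sewing contributes \<open>C\<^sub>T\<close> and freezing
  contributes \<open>M\<close>, both uniformly in \<open>\<tau>\<close>.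
\<close>

lemma Lambda_q_norm_le:
  assumes h: "h \<in> ZC1_hat X N S T"
  shows "fam_norm X N T (Lambda_q X N S I T h) \<le> ennreal C\<^sub>T * ennreal M * norm1 X N T h"
  unfolding fam_norm_def
proof (rule SUP_least)
  fix \<tau> assume "\<tau> \<in> {0..T}"
  then have \<tau>: "0 \<le> \<tau>" "\<tau> \<le> T" by auto
  have ZC1: "frozen S \<tau> h \<in> ZC1 X N \<tau>"
    using frozen_ZC1[OF h \<tau>] .
  have "qnorm X N \<tau> (Lambda_q X N S I T h \<tau>) \<le> log_norm N \<tau> (r_d S I \<tau> h)"
    unfolding qnorm_def Lambda_q_eq_primitives[OF h \<tau>]
    using r_d_primitive[OF h \<tau>] r_d_C_log[OF h \<tau>] by (intro INF_lower) auto
  also have "\<dots> \<le> ennreal C\<^sub>T * norm1 X N \<tau> (frozen S \<tau> h)"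
    unfolding r_d_def Lambda_d_def
    using log_estimate[OF \<tau> base_germ_A1[OF ZC1]] delta_base_germ[of "frozen S \<tau> h" \<tau>] ZC1 \<tau>
    by (simp add: ZC1_def C1_def)
  also have "\<dots> \<le> ennreal C\<^sub>T * (ennreal M * norm1 X N T h)"
    using h \<tau> by (intro mult_left_mono norm1_frozen_le) (auto simp: ZC1_hat_def)
  finally show "qnorm X N \<tau> (Lambda_q X N S I T h \<tau>) \<le> ennreal C\<^sub>T * ennreal M * norm1 X N T h"
    by (simp add: mult.assoc)
qed

lemma Lambda_q_mem:
  assumes h: "h \<in> ZC1_hat X N S T"
  shows "Lambda_q X N S I T h \<in> Q_fr X N S T"
proof -
  have cont: "h \<in> cont_maps X N 3 T" and fin: "norm1 X N T h < \<infinity>"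
    using h by (auto simp: ZC1_hat_def C1_def)
  have "Lambda_q X N S I T h \<in> (\<Pi>\<^sub>E \<tau>\<in>{0..T}. QC_log X N \<tau>)"
  proof (rule PiE_I)
    fix \<tau> assume "\<tau> \<in> {0..T}"
    then have \<tau>: "0 \<le> \<tau>" "\<tau> \<le> T" by auto
    have "r_d S I \<tau> h \<in> qclass X N \<tau> (r_d S I \<tau> h) \<inter> C_log X N \<tau>"
      using r_d_primitive[OF h \<tau>] qclass_eq_primitivesI r_d_C_log[OF h \<tau>] by blast
    moreover have "r_d S I \<tau> h \<in> cont_maps X N 2 \<tau>"
      using r_d_primitive[OF h \<tau>] by (simp add: primitives_def)
    ultimately show "Lambda_q X N S I T h \<tau> \<in> QC_log X N \<tau>"
      using \<tau> unfolding QC_log_def Lambda_q_def by auto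
  qed (auto simp: Lambda_q_def)
  moreover have "Res X N \<sigma> (Lambda_q X N S I T h \<tau>) = Trans X N S \<tau> \<sigma> (Lambda_q X N S I T h \<sigma>)"
    if "0 \<le> \<sigma>" "\<sigma> \<le> \<tau>" "\<tau> \<le> T" for \<tau> \<sigma>
  proof -
    have "primitives X N \<tau> (frozen S \<tau> h) \<noteq> {}" "primitives X N \<sigma> (frozen S \<sigma> h) \<noteq> {}"
      using r_d_primitive[OF h, of \<tau>] r_d_primitive[OF h, of \<sigma>] that by auto
    then show ?thesis
      using that frozen_transport[OF cont \<open>\<sigma> \<le> \<tau>\<close>]
      by (simp add: Lambda_q_eq_primitives[OF h] Res_primitives Trans_primitives)
  qed
  moreover have "fam_norm X N T (Lambda_q X N S I T h) < \<infinity>"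
  proof -
    have "ennreal C\<^sub>T * ennreal M * norm1 X N T h < \<infinity>"
      using fin by (simp add: ennreal_mult_less_top)
    then show ?thesis
      using Lambda_q_norm_le[OF h] by (rule le_less_trans[rotated])
  qed
  ultimately show ?thesis
    by (simp add: Q_fr_def)
qed

lemma Lambda_q_add:
  assumes h: "h \<in> ZC1_hat X N S T" and k: "k \<in> ZC1_hat X N S T"
  shows "Lambda_q X N S I T (\<lambda>ts. h ts + k ts)
    = fam_add X N T (Lambda_q X N S I T h) (Lambda_q X N S I T k)"
proof
  fix \<tau>
  have hk: "(\<lambda>ts. h ts + k ts) \<in> ZC1_hat X N S T"
    using ZC1_hat_lincomb[OF h k, of 1 1] by simp
  show "Lambda_q X N S I T (\<lambda>ts. h ts + k ts) \<tau>
      = fam_add X N T (Lambda_q X N S I T h) (Lambda_q X N S I T k) \<tau>"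
  proof (cases "\<tau> \<in> {0..T}")
    case True
    then have \<tau>: "0 \<le> \<tau>" "\<tau> \<le> T" by auto
    have "frozen S \<tau> (\<lambda>ts. h ts + k ts) = (\<lambda>ts. frozen S \<tau> h ts + frozen S \<tau> k ts)"
      using frozen_lincomb[of h k \<tau> 1 1] h k by (simp add: ZC1_hat_def C1_def)
    then show ?thesis
      using True r_d_primitive[OF h \<tau>] r_d_primitive[OF k \<tau>]
      by (simp add: fam_add_def Lambda_q_eq_primitives[OF hk \<tau>] Lambda_q_eq_primitives[OF h \<tau>]
          Lambda_q_eq_primitives[OF k \<tau>]) (subst qadd_primitives; auto)
  qed (auto simp: Lambda_q_def fam_add_def)
qed

lemma Lambda_q_scale:
  assumes h: "h \<in> ZC1_hat X N S T"
  shows "Lambda_q X N S I T (\<lambda>ts. a *\<^sub>R h ts) = fam_scale X N T a (Lambda_q X N S I T h)"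
proof
  fix \<tau>
  have ah: "(\<lambda>ts. a *\<^sub>R h ts) \<in> ZC1_hat X N S T"
    using ZC1_hat_lincomb[OF h h, of a 0] by simp
  show "Lambda_q X N S I T (\<lambda>ts. a *\<^sub>R h ts) \<tau> = fam_scale X N T a (Lambda_q X N S I T h) \<tau>"
  proof (cases "\<tau> \<in> {0..T}")
    case True
    then have \<tau>: "0 \<le> \<tau>" "\<tau> \<le> T" by auto
    have "frozen S \<tau> (\<lambda>ts. a *\<^sub>R h ts) = (\<lambda>ts. a *\<^sub>R frozen S \<tau> h ts)"
      using frozen_lincomb[of h h \<tau> a 0] h by (simp add: ZC1_hat_def C1_def)
    then show ?thesis
      using True r_d_primitive[OF h \<tau>]
      by (simp add: fam_scale_def Lambda_q_eq_primitives[OF ah \<tau>] Lambda_q_eq_primitives[OF h \<tau>])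
        (subst qscale_primitives; auto)
  qed (auto simp: Lambda_q_def fam_scale_def)
qed

text \<open>
  By linearity the difference of the images is the image of the difference, to which the norm
  estimate applies.
\<close>

lemma Lambda_q_continuous:
  assumes h: "h \<in> ZC1_hat X N S T" and e: "e > 0"
  shows "\<exists>d>0. \<forall>k\<in>ZC1_hat X N S T. norm1 X N T (\<lambda>ts. k ts - h ts) < ennreal d \<longrightarrow>
    fam_norm X N T (fam_diff X N T (Lambda_q X N S I T k) (Lambda_q X N S I T h)) < ennreal e"
\<comment> \<open>The summand \<open>1\<close> keeps the denominator positive when \<open>M = 0\<close> and makes the final bound strict.\<close>
proof (intro exI[of _ "e / (C\<^sub>T * M + 1)"] conjI ballI impI)
  let ?d = "e / (C\<^sub>T * M + 1)"
  have CM: "0 \<le> C\<^sub>T * M"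
    using const_pos M_nonneg by simp
  show "?d > 0"
    using CM e by simp
  have less: "C\<^sub>T * M * ?d < e"
    using CM e by (simp add: field_simps)
  fix k assume k: "k \<in> ZC1_hat X N S T" and close: "norm1 X N T (\<lambda>ts. k ts - h ts) < ennreal ?d"
  have neg: "(\<lambda>ts. (- 1) *\<^sub>R h ts) \<in> ZC1_hat X N S T"
    and kh: "(\<lambda>ts. k ts - h ts) \<in> ZC1_hat X N S T"
    using ZC1_hat_lincomb[OF h h, of "-1" 0] ZC1_hat_lincomb[OF k h, of 1 "-1"] by simp_all
  have "fam_diff X N T (Lambda_q X N S I T k) (Lambda_q X N S I T h)
      = Lambda_q X N S I T (\<lambda>ts. k ts - h ts)"
    using Lambda_q_add[OF k neg] by (simp add: fam_diff_def Lambda_q_scale[OF h, symmetric])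
  then have "fam_norm X N T (fam_diff X N T (Lambda_q X N S I T k) (Lambda_q X N S I T h))
      \<le> ennreal (C\<^sub>T * M) * norm1 X N T (\<lambda>ts. k ts - h ts)"
    using Lambda_q_norm_le[OF kh] const_pos M_nonneg by (simp add: ennreal_mult)
  also have "\<dots> \<le> ennreal (C\<^sub>T * M) * ennreal ?d"
    using close by (intro mult_left_mono) auto
  also have "\<dots> < ennreal e"
    using less CM e \<open>?d > 0\<close> by (simp add: ennreal_mult[symmetric] ennreal_lessI del: times_divide_eq_right)
  finally show "fam_norm X N T (fam_diff X N T (Lambda_q X N S I T k) (Lambda_q X N S I T h))
      < ennreal e" .
qed

end

theorem theorem5p10:
  fixes B :: "real \<Rightarrow> 'v::real_vector set" and N :: "real \<Rightarrow> 'v \<Rightarrow> real"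
    and S :: "real \<Rightarrow> 'v \<Rightarrow> 'v" and T \<alpha> C\<^sub>T :: real
    and I :: "real \<Rightarrow> (real list \<Rightarrow> 'v) \<Rightarrow> real list \<Rightarrow> 'v"
  assumes "0 < T"
    and "analytic_semigroup_on_scale B N T S"
    and "dyadic_sewing (B \<alpha>) (N \<alpha>) T I C\<^sub>T"
  shows
      "(\<forall>h\<in>ZC1_hat (B \<alpha>) (N \<alpha>) S T.
          (\<forall>\<tau>\<in>{0..T}. frozen S \<tau> h \<in> ZC1 (B \<alpha>) (N \<alpha>) \<tau>
            \<and> base_germ \<tau> (frozen S \<tau> h) \<in> A1 (B \<alpha>) (N \<alpha>) \<tau>)
          \<and> Lambda_q (B \<alpha>) (N \<alpha>) S I T h \<in> Q_fr (B \<alpha>) (N \<alpha>) S T)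
     \<and> (\<forall>h\<in>ZC1_hat (B \<alpha>) (N \<alpha>) S T. \<forall>k\<in>ZC1_hat (B \<alpha>) (N \<alpha>) S T.
          (\<lambda>ts. h ts + k ts) \<in> ZC1_hat (B \<alpha>) (N \<alpha>) S T
          \<and> Lambda_q (B \<alpha>) (N \<alpha>) S I T (\<lambda>ts. h ts + k ts)
            = fam_add (B \<alpha>) (N \<alpha>) T
                (Lambda_q (B \<alpha>) (N \<alpha>) S I T h) (Lambda_q (B \<alpha>) (N \<alpha>) S I T k))
     \<and> (\<forall>h\<in>ZC1_hat (B \<alpha>) (N \<alpha>) S T. \<forall>a.
          (\<lambda>ts. a *\<^sub>R h ts) \<in> ZC1_hat (B \<alpha>) (N \<alpha>) S T
          \<and> Lambda_q (B \<alpha>) (N \<alpha>) S I T (\<lambda>ts. a *\<^sub>R h ts)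
            = fam_scale (B \<alpha>) (N \<alpha>) T a (Lambda_q (B \<alpha>) (N \<alpha>) S I T h))
     \<and> (\<forall>h\<in>ZC1_hat (B \<alpha>) (N \<alpha>) S T. \<forall>e::real. e > 0 \<longrightarrow>
          (\<exists>d::real. d > 0 \<and> (\<forall>k\<in>ZC1_hat (B \<alpha>) (N \<alpha>) S T.
            norm1 (B \<alpha>) (N \<alpha>) T (\<lambda>ts. k ts - h ts) < ennreal d \<longrightarrow>
            fam_norm (B \<alpha>) (N \<alpha>) T
              (fam_diff (B \<alpha>) (N \<alpha>) T
                (Lambda_q (B \<alpha>) (N \<alpha>) S I T k) (Lambda_q (B \<alpha>) (N \<alpha>) S I T h)) < ennreal e)))
     \<and> (\<forall>h\<in>ZC1_hat (B \<alpha>) (N \<alpha>) S T. \<forall>\<tau>\<in>{0..T}.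
          \<forall>r\<in>Lambda_q (B \<alpha>) (N \<alpha>) S I T h \<tau>. delta 2 \<tau> r = frozen S \<tau> h)
     \<and> (\<forall>h\<in>ZC1_hat (B \<alpha>) (N \<alpha>) S T. \<forall>s u t. 0 \<le> s \<and> s \<le> u \<and> u \<le> t \<and> t \<le> T \<longrightarrow>
          (\<forall>r\<in>Lambda_q (B \<alpha>) (N \<alpha>) S I T h t. delta 2 t r [t, u, s] = h [t, u, s]))
     \<and> (\<forall>h\<in>ZC1_hat (B \<alpha>) (N \<alpha>) S T.
          fam_norm (B \<alpha>) (N \<alpha>) T (Lambda_q (B \<alpha>) (N \<alpha>) S I T h)
          \<le> ennreal C\<^sub>T * semigroup_bound (B \<alpha>) (N \<alpha>) T S * norm1 (B \<alpha>) (N \<alpha>) T h)"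
proof -
  interpret analytic_semigroup_on_scale B N T S by fact
  interpret sg: C0_semigroup_on "B \<alpha>" "N \<alpha>" S by (rule semigroup)
  obtain M where M: "semigroup_bound (B \<alpha>) (N \<alpha>) T S = ennreal M" "0 \<le> M"
    using bound_finite[of \<alpha>] by (cases "semigroup_bound (B \<alpha>) (N \<alpha>) T S") auto
  have bound: "N \<alpha> (S r x) \<le> M * N \<alpha> x" if "0 \<le> r" "r \<le> T" "x \<in> B \<alpha>" for r x
  proof (rule sg.operator_norm_bound)
    show "operator_norm (B \<alpha>) (N \<alpha>) (S r) \<le> ennreal M"
      unfolding M(1)[symmetric] semigroup_bound_def using that by (intro SUP_upper) auto
  qed (use that M sg.bounded in auto)
  interpret bounded_C0_semigroup "B \<alpha>" "N \<alpha>" S T M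
    by unfold_locales (use M bound in auto)
  interpret dyadic_sewing "B \<alpha>" "N \<alpha>" T I C\<^sub>T by fact
  interpret frozen_sewing "B \<alpha>" "N \<alpha>" S T M I C\<^sub>T ..
  have primitive: "delta 2 \<tau> r = frozen S \<tau> h"
    if "h \<in> ZC1_hat (B \<alpha>) (N \<alpha>) S T" "0 \<le> \<tau>" "\<tau> \<le> T"
      "r \<in> Lambda_q (B \<alpha>) (N \<alpha>) S I T h \<tau>" for h \<tau> r
    using that(4) unfolding Lambda_q_eq_primitives[OF that(1-3)] by (simp add: primitives_def)
  show ?thesis
  proof (intro conjI ballI allI impI)
    fix h s u t r
    assume h: "h \<in> ZC1_hat (B \<alpha>) (N \<alpha>) S T" and ord: "0 \<le> s \<and> s \<le> u \<and> u \<le> t \<and> t \<le> T"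
      and r: "r \<in> Lambda_q (B \<alpha>) (N \<alpha>) S I T h t"
    have "h [t, u, s] \<in> B \<alpha>"
      using h sg.cont_maps_mem by (auto simp: ZC1_hat_def C1_def)
    then show "delta 2 t r [t, u, s] = h [t, u, s]"
      using primitive[OF h _ _ r] ord by (simp add: frozen_3 sg.zero)
  next
    fix h k assume hk: "h \<in> ZC1_hat (B \<alpha>) (N \<alpha>) S T" "k \<in> ZC1_hat (B \<alpha>) (N \<alpha>) S T"
    show "(\<lambda>ts. h ts + k ts) \<in> ZC1_hat (B \<alpha>) (N \<alpha>) S T"
      using ZC1_hat_lincomb[OF hk, of 1 1] by simp
  next
    fix h a assume h: "h \<in> ZC1_hat (B \<alpha>) (N \<alpha>) S T"
    show "(\<lambda>ts. a *\<^sub>R h ts) \<in> ZC1_hat (B \<alpha>) (N \<alpha>) S T"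
      using ZC1_hat_lincomb[OF h h, of a 0] by simp
  qed (use Lambda_q_norm_le in \<open>auto simp: M frozen_ZC1 sg.base_germ_A1 Lambda_q_mem Lambda_q_add
      Lambda_q_scale Lambda_q_continuous primitive\<close>)
qed

end
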